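(* Let $N\ge 1$, let $B$ be the unit ball of $\mathbb{R}^N$, and let $f\in C^1(\mathbb{R})$. Assume that there exists $a\in\mathbb{R}$ such that $f(a)>0$ and $f(t)\ge 0$ for all $t>a$, and, with $F(t)=\int_a^t f(s)\,ds$, that $\int^{+\infty}\frac{dt}{\sqrt{F(t)}}<+\infty$. Assume in addition that there exist an increasing function $\tilde f:\mathbb{R}\to\mathbb{R}$ and a constant $K$ such that $f(t)=\tilde f(t)-Kt$ for all $t\in\mathbb{R}$. Let $u_1,u_2$ be two large solutions of $\Delta u=f(u)$ in $B$. Then $$|\nabla(u_1-u_2)|\in L^\infty(B).$$
   Context: A large solution of $\Delta u=f(u)$ in $B$ is a classical solution $u$ of $\Delta u=f(u)$ in $B$ such that $\lim_{x\to x_0,\,x\in B}u(x)=+\infty$ for every $x_0\in\partial B$. *)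

theory Defs
  imports "HOL-Analysis.Analysis"
begin

text \<open>
  Throughout, \<open>S\<close> is meant to be an open set, so that \<^term>\<open>at x\<close> for \<open>x \<in> S\<close> only sees
  values of the function inside \<open>S\<close>; the values outside \<open>S\<close> are irrelevant.
\<close>

definition partial_deriv :: "'a::euclidean_space \<Rightarrow> ('a \<Rightarrow> real) \<Rightarrow> 'a \<Rightarrow> real" where
  "partial_deriv b u x = frechet_derivative u (at x) b"

definition C1_on :: "'a::euclidean_space set \<Rightarrow> ('a \<Rightarrow> real) \<Rightarrow> bool" where
  "C1_on S u \<longleftrightarrow> (\<forall>x\<in>S. u differentiable (at x)) \<and>
                 (\<forall>b\<in>Basis. continuous_on S (partial_deriv b u))"

definition C2_on :: "'a::euclidean_space set \<Rightarrow> ('a \<Rightarrow> real) \<Rightarrow> bool" where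
  "C2_on S u \<longleftrightarrow> C1_on S u \<and> (\<forall>b\<in>Basis. C1_on S (partial_deriv b u))"

definition gradient :: "('a::euclidean_space \<Rightarrow> real) \<Rightarrow> 'a \<Rightarrow> 'a" where
  "gradient u x = (\<Sum>b\<in>Basis. partial_deriv b u x *\<^sub>R b)"

definition laplacian :: "('a::euclidean_space \<Rightarrow> real) \<Rightarrow> 'a \<Rightarrow> real" where
  "laplacian u x = (\<Sum>b\<in>Basis. partial_deriv b (partial_deriv b u) x)"

definition classical_solution ::
    "(real \<Rightarrow> real) \<Rightarrow> 'a::euclidean_space set \<Rightarrow> ('a \<Rightarrow> real) \<Rightarrow> bool" where
  "classical_solution f S u \<longleftrightarrow> C2_on S u \<and> (\<forall>x\<in>S. laplacian u x = f (u x))"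

definition large_solution ::
    "(real \<Rightarrow> real) \<Rightarrow> 'a::euclidean_space set \<Rightarrow> ('a \<Rightarrow> real) \<Rightarrow> bool" where
  "large_solution f S u \<longleftrightarrow>
     classical_solution f S u \<and> (\<forall>x0\<in>frontier S. filterlim u at_top (at x0 within S))"

definition in_Linfty :: "'a::euclidean_space set \<Rightarrow> ('a \<Rightarrow> real) \<Rightarrow> bool" where
  "in_Linfty S g \<longleftrightarrow> g \<in> borel_measurable (lebesgue_on S) \<and>
                      (\<exists>C. AE x in lebesgue_on S. \<bar>g x\<bar> \<le> C)"

end

theory Submission
  imports Defs
begin

text \<open>
  Comparison near the boundary rests on \<open>f s - f t \<ge> - K (s - t)\<close> for \<open>t \<le> s\<close>. On spheres \<open>|x| = r\<close>, the maximum \<open>M(r)\<close> and the minimum \<open>m(r)\<close> of the solutions are radial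
  sub- and supersolutions.
  In the radial variable \<open>\<tau>\<close> with \<open>dr = r\<^sup>N\<^sup>-\<^sup>1 d\<tau>\<close> the radial Laplacian is a multiple of \<open>d\<^sup>2/d\<tau>\<^sup>2\<close>, so an
  affine contraction of \<open>\<tau>\<close> that moves the blow-up into the ball keeps \<open>m\<close> a supersolution where
  \<open>f \<ge> 0\<close>; letting the contraction tend to the identity gives \<open>M(r) - m(r) \<le> C (1 - r)\<close>.
  Comparing a solution with its small rotations then bounds its tangential gradient.
  For the radial derivative put \<open>w = u\<^sub>1 - u\<^sub>2\<close>. Both \<open>M - m + w\<close> and \<open>M - m - w\<close> are subharmonic up to
  bounded errors. The sum of the first and the Kelvin transform of the second
  in a sphere \<open>|x| = r\<^sub>0\<close> is constant on that sphere, since there \<open>w\<close> cancels. Hence it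
  lies below a barrier with a bounded slope, and its normal derivative contains \<open>2 w\<^sub>r\<close>.
\<close>

section \<open>Solutions along curves and on spheres\<close>

text \<open>The hypotheses bound \<open>f s - f t\<close> from below only, and only for
  \<open>t \<le> s\<close>, while the solutions blow up. So f(u1) - f(u2) = \<Delta>w has no a
  priori bound near the boundary, and no gradient estimate for w can be read off from the size of
  \<Delta>w. Every comparison is therefore arranged so that values of \<open>f\<close> occur in
  ordered pairs. Adding M - m achieves this for w: the terms f(M) - f(m) + f(u1) - f(u2) regroup as
  (f(M) - f(u2)) + (f(u1) - f(m)), and each bracket is at least -K C, its arguments being ordered
  and at most C apart.

  The slope of the barrier must not depend on r0. The rate C (1 - r), rather than mere convergence
  of M - m to 0, provides this: the barrier lives on a shell whose logarithmic thickness is half of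
  |log r0|, and on that shell and its reflection M - m and |w| are at most a multiple of |log r0|,
  so the ratio of height to width stays bounded.\<close>

definition blowup_solution :: "(real \<Rightarrow> real) \<Rightarrow> ('a::euclidean_space \<Rightarrow> real) \<Rightarrow> ('a \<Rightarrow> 'a) \<Rightarrow> ('a \<Rightarrow> 'a \<Rightarrow> 'a) \<Rightarrow> bool" where
  "blowup_solution f u G H \<longleftrightarrow>
     (\<forall>x\<in>ball 0 1. (u has_derivative (\<lambda>h. G x \<bullet> h)) (at x) \<and> (G has_derivative H x) (at x) \<and>
        (\<Sum>b\<in>Basis. H x b \<bullet> b) = f (u x)) \<and>
     (\<forall>c. \<exists>r<1. \<forall>x. r \<le> norm x \<longrightarrow> norm x < 1 \<longrightarrow> c \<le> u x)"

lemma solD: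
  assumes "blowup_solution f u G H" "norm x < 1"
  shows "(u has_derivative (\<lambda>h. G x \<bullet> h)) (at x)" "(G has_derivative H x) (at x)"
    "(\<Sum>b\<in>Basis. H x b \<bullet> b) = f (u x)" "linear (H x)"
proof -
  show "(u has_derivative (\<lambda>h. G x \<bullet> h)) (at x)" "(\<Sum>b\<in>Basis. H x b \<bullet> b) = f (u x)"
    and G: "(G has_derivative H x) (at x)"
    using assms by (simp_all add: blowup_solution_def)
  show "linear (H x)" using G by (rule has_derivative_linear)
qed

lemma sol_blowup:
  assumes "blowup_solution f u G H"
  obtains r where "r < 1" "\<And>x. r \<le> norm x \<Longrightarrow> norm x < 1 \<Longrightarrow> c \<le> u x"
  using assms unfolding blowup_solution_def by blast

lemma sol_continuous:
  assumes "blowup_solution f u G H"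
  shows "continuous_on (ball 0 1) u" "continuous_on (ball 0 1) G"
proof -
  have "isCont u x" "isCont G x" if "x \<in> ball 0 1" for x
    using solD(1,2)[OF assms, of x] that by (auto intro: has_derivative_continuous)
  then show "continuous_on (ball 0 1) u" "continuous_on (ball 0 1) G"
    by (auto intro: continuous_at_imp_continuous_on)
qed

lemma sol_curve:
  assumes "blowup_solution f u G H" "norm (\<gamma> s) < 1" "(\<gamma> has_vector_derivative d) (at s)"
  shows "((\<lambda>s. u (\<gamma> s)) has_real_derivative G (\<gamma> s) \<bullet> d) (at s)"
    and "(e has_vector_derivative e') (at s) \<Longrightarrow>
      ((\<lambda>s. G (\<gamma> s) \<bullet> e s) has_real_derivative H (\<gamma> s) d \<bullet> e s + G (\<gamma> s) \<bullet> e') (at s)"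
proof -
  note D = solD[OF assms(1,2)]
  have g: "(\<gamma> has_derivative (\<lambda>h. h *\<^sub>R d)) (at s)"
    using assms(3) by (simp add: has_vector_derivative_def)
  show "((\<lambda>s. u (\<gamma> s)) has_real_derivative G (\<gamma> s) \<bullet> d) (at s)"
    using has_derivative_compose[OF g D(1)] unfolding has_field_derivative_def
    by (rule has_derivative_eq_rhs) (simp add: fun_eq_iff)
  assume "(e has_vector_derivative e') (at s)"
  then have e: "(e has_derivative (\<lambda>h. h *\<^sub>R e')) (at s)"
    by (simp add: has_vector_derivative_def)
  show "((\<lambda>s. G (\<gamma> s) \<bullet> e s) has_real_derivative H (\<gamma> s) d \<bullet> e s + G (\<gamma> s) \<bullet> e') (at s)"
    unfolding has_field_derivative_def
    by (rule has_derivative_eq_rhs[OF has_derivative_inner[OF has_derivative_compose[OF g D(2)] e]])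
      (simp add: fun_eq_iff linear_scale[OF D(4)] algebra_simps)
qed

section \<open>Second-order conditions at maxima on spheres\<close>

lemma second_derivative_at_max:
  fixes g :: "real \<Rightarrow> real"
  assumes e: "e > 0" and g: "\<And>s. \<bar>s - x\<bar> < e \<Longrightarrow> (g has_real_derivative g' s) (at s)"
    and g': "(g' has_real_derivative D) (at x)"
    and max: "\<And>s. \<bar>s - x\<bar> < e \<Longrightarrow> g s \<le> g x"
  shows "D \<le> 0"
proof (rule ccontr)
  assume "\<not> D \<le> 0"
  then obtain d where d: "d > 0" "\<And>h. 0 < h \<Longrightarrow> h < d \<Longrightarrow> g' x < g' (x + h)"
    using DERIV_pos_inc_right[OF g'] by force
  have "g' x = 0"
    using DERIV_local_max[OF g[of x] e] max e by (auto simp: abs_minus_commute)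
  define m where "m = min d e / 2"
  have m: "0 < m" "m < d" "m < e" using d e by (auto simp: m_def min_def)
  have "\<exists>z>x. z < x + m \<and> g (x + m) - g x = (x + m - x) * g' z"
    using m by (intro MVT2) (auto intro!: g)
  then obtain z where z: "x < z" "z < x + m" "g (x + m) - g x = m * g' z" by auto
  have "g' z > 0" using d(2)[of "z - x"] z m \<open>g' x = 0\<close> by simp
  then have "g (x + m) > g x" using z m by (smt (verit) mult_pos_pos)
  then show False using max[of "x + m"] m by simp
qed

text \<open>Increments are controlled for \<open>h > 0\<close> only, because the bounds fed into it
  are proved on one side of the point.\<close>

lemma derivative_le:
  fixes g :: "real \<Rightarrow> real"
  assumes "(g has_real_derivative D) (at x)" "0 < d"
    and "\<And>h. 0 < h \<Longrightarrow> h < d \<Longrightarrow> g (x + h) \<le> g x + c * h"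
  shows "D \<le> c"
proof (rule ccontr)
  assume "\<not> D \<le> c"
  moreover have "((\<lambda>s. g s - c * s) has_real_derivative D - c) (at x)"
    using assms(1) by (auto intro!: derivative_eq_intros)
  ultimately obtain d' where d': "d' > 0" "\<And>h. 0 < h \<Longrightarrow> h < d' \<Longrightarrow> g x - c * x < g (x + h) - c * (x + h)"
    using DERIV_pos_inc_right[of "\<lambda>s. g s - c * s" "D - c" x] by auto
  define m where "m = min d d' / 2"
  have "0 < m" "m < d" "m < d'" using d'(1) assms(2) by (auto simp: m_def min_def)
  then show False using d'(2)[of m] assms(3)[of m] by (simp add: algebra_simps)
qed

lemma trace_orthonormal:
  fixes A :: "'a::euclidean_space \<Rightarrow> 'a"
  assumes A: "linear A" and S: "pairwise orthogonal S" "\<And>x. x \<in> S \<Longrightarrow> norm x = 1" "span S = UNIV" "finite S"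
  shows "(\<Sum>s\<in>S. A s \<bullet> s) = (\<Sum>b\<in>Basis. A b \<bullet> b)"
proof -
  have "(\<Sum>s\<in>S. A s \<bullet> s) = (\<Sum>s\<in>S. \<Sum>b\<in>Basis. (s \<bullet> b) * (A b \<bullet> s))"
  proof (rule sum.cong[OF refl])
    fix s
    have "A s = A (\<Sum>b\<in>Basis. (s \<bullet> b) *\<^sub>R b)" by (simp add: euclidean_representation)
    then have "A s = (\<Sum>b\<in>Basis. (s \<bullet> b) *\<^sub>R A b)" by (simp add: linear_sum[OF A] linear_scale[OF A])
    then show "A s \<bullet> s = (\<Sum>b\<in>Basis. (s \<bullet> b) * (A b \<bullet> s))" by (simp add: inner_sum_left)
  qed
  also have "\<dots> = (\<Sum>b\<in>Basis. A b \<bullet> (\<Sum>s\<in>S. (s \<bullet> b) *\<^sub>R s))"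
    by (subst sum.swap) (simp add: inner_sum_right)
  also have "\<dots> = (\<Sum>b\<in>Basis. A b \<bullet> b)"
  proof (rule sum.cong[OF refl])
    fix b :: 'a
    have "(\<Sum>s\<in>S. (b \<bullet> s) *\<^sub>R s) = b"
      by (rule orthonormal_basis_expand) (use S in \<open>auto simp: pairwise_def\<close>)
    then show "A b \<bullet> (\<Sum>s\<in>S. (s \<bullet> b) *\<^sub>R s) = A b \<bullet> b" by (simp add: inner_commute)
  qed
  finally show ?thesis .
qed

text \<open>By the equation this radial part of \<open>\<Delta>u\<close> at \<open>r \<sigma>\<close> determines the spherical part, which needs no definition of its own.\<close>

definition radlap :: "('a::euclidean_space \<Rightarrow> 'a) \<Rightarrow> ('a \<Rightarrow> 'a \<Rightarrow> 'a) \<Rightarrow> real \<Rightarrow> 'a \<Rightarrow> real" where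
  "radlap G H r \<sigma> = H (r *\<^sub>R \<sigma>) \<sigma> \<bullet> \<sigma> + (real DIM('a) - 1) / r * (G (r *\<^sub>R \<sigma>) \<bullet> \<sigma>)"

text \<open>By the equation in polar coordinates, r^2 (f(u) - \<open>radlap\<close>) is the
  Laplacian on the unit sphere of the map \<sigma> \<mapsto> u(r \<sigma>); at a maximum it is a sum
  of nonpositive second derivatives along great circles. Signed weights \<open>c k\<close> and
  separate radii \<open>r k\<close> let one statement serve a single solution, a difference on one
  sphere, and a combination across two concentric spheres.\<close>

lemma spherical_max:
  fixes \<sigma> :: "'a::euclidean_space"
  assumes I: "finite I" and u: "\<And>k. k \<in> I \<Longrightarrow> blowup_solution f (u k) (G k) (H k)"
    and r: "\<And>k. k \<in> I \<Longrightarrow> 0 < r k \<and> r k < 1" and \<sigma>: "norm \<sigma> = 1"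
    and max: "\<And>\<sigma>'. norm \<sigma>' = 1 \<Longrightarrow> (\<Sum>k\<in>I. c k * u k (r k *\<^sub>R \<sigma>')) \<le> (\<Sum>k\<in>I. c k * u k (r k *\<^sub>R \<sigma>))"
  shows "(\<Sum>k\<in>I. c k * (r k)\<^sup>2 * (f (u k (r k *\<^sub>R \<sigma>)) - radlap (G k) (H k) (r k) \<sigma>)) \<le> 0"
proof -
  obtain S where S: "\<sigma> \<in> S" "pairwise orthogonal S" "\<And>x. x \<in> S \<Longrightarrow> norm x = 1"
    "independent S" "card S = DIM('a)" "span S = UNIV"
    using vector_in_orthonormal_basis[OF \<sigma>] by metis
  have fin: "finite S" using S(4) by (rule finiteI_independent)
  have tan: "(\<Sum>k\<in>I. c k * ((r k)\<^sup>2 * (H k (r k *\<^sub>R \<sigma>) \<tau> \<bullet> \<tau>) - r k * (G k (r k *\<^sub>R \<sigma>) \<bullet> \<sigma>))) \<le> 0"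
    if \<tau>: "\<tau> \<in> S - {\<sigma>}" for \<tau>
  proof -
    have orth: "\<sigma> \<bullet> \<tau> = 0" "\<tau> \<bullet> \<tau> = 1" "\<sigma> \<bullet> \<sigma> = 1"
      using S(1-3) \<tau> \<sigma> by (auto simp: pairwise_def orthogonal_def norm_eq_1)
    \<comment> \<open>The great circle through \<open>\<sigma>\<close> in the direction
      \<open>\<tau>\<close>. Its acceleration \<open>- \<gamma>\<close> produces the term - r (G
      \<bullet> \<sigma>), which summed over the N - 1 tangent directions is the first-order part of
      \<open>radlap\<close>.\<close>
    define \<gamma> where "\<gamma> = (\<lambda>s. cos s *\<^sub>R \<sigma> + sin s *\<^sub>R \<tau>)"
    define \<eta> where "\<eta> = (\<lambda>s. (- sin s) *\<^sub>R \<sigma> + cos s *\<^sub>R \<tau>)"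
    have n: "norm (\<gamma> s) = 1" for s
      using sin_cos_squared_add[of s] orth
      by (simp add: norm_eq_1 \<gamma>_def inner_add_left inner_add_right inner_commute power2_eq_square)
    have d1: "((\<lambda>s. r k *\<^sub>R \<gamma> s) has_vector_derivative r k *\<^sub>R \<eta> s) (at s)" for k s
      unfolding \<gamma>_def \<eta>_def has_vector_derivative_def
      by (auto intro!: derivative_eq_intros simp: algebra_simps)
    have d2: "((\<lambda>s. r k *\<^sub>R \<eta> s) has_vector_derivative - (r k *\<^sub>R \<gamma> s)) (at s)" for k s
      unfolding \<gamma>_def \<eta>_def has_vector_derivative_def
      by (auto intro!: derivative_eq_intros simp: algebra_simps)
    have n1: "norm (r k *\<^sub>R \<gamma> s) < 1" if "k \<in> I" for k s using r[OF that] n by simp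
    have "(\<Sum>k\<in>I. c k * (H k (r k *\<^sub>R \<gamma> 0) (r k *\<^sub>R \<eta> 0) \<bullet> (r k *\<^sub>R \<eta> 0)
        + G k (r k *\<^sub>R \<gamma> 0) \<bullet> (- (r k *\<^sub>R \<gamma> 0)))) \<le> 0"
    proof (rule second_derivative_at_max[where e = 1 and x = 0 and
          g = "\<lambda>s. \<Sum>k\<in>I. c k * u k (r k *\<^sub>R \<gamma> s)" and
          g' = "\<lambda>s. \<Sum>k\<in>I. c k * (G k (r k *\<^sub>R \<gamma> s) \<bullet> (r k *\<^sub>R \<eta> s))"])
      show "((\<lambda>s. \<Sum>k\<in>I. c k * u k (r k *\<^sub>R \<gamma> s)) has_real_derivative
        (\<Sum>k\<in>I. c k * (G k (r k *\<^sub>R \<gamma> s) \<bullet> (r k *\<^sub>R \<eta> s)))) (at s)" for s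
        by (intro DERIV_sum DERIV_cmult sol_curve(1)[OF u n1 d1])
      show "((\<lambda>s. \<Sum>k\<in>I. c k * (G k (r k *\<^sub>R \<gamma> s) \<bullet> (r k *\<^sub>R \<eta> s))) has_real_derivative
        (\<Sum>k\<in>I. c k * (H k (r k *\<^sub>R \<gamma> 0) (r k *\<^sub>R \<eta> 0) \<bullet> (r k *\<^sub>R \<eta> 0)
        + G k (r k *\<^sub>R \<gamma> 0) \<bullet> (- (r k *\<^sub>R \<gamma> 0))))) (at 0)"
        by (intro DERIV_sum DERIV_cmult sol_curve(2)[OF u n1 d1 d2])
      show "(\<Sum>k\<in>I. c k * u k (r k *\<^sub>R \<gamma> s)) \<le> (\<Sum>k\<in>I. c k * u k (r k *\<^sub>R \<gamma> 0))" for s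
        using max[OF n, of s] by (simp add: \<gamma>_def)
    qed auto
    also have "(\<Sum>k\<in>I. c k * (H k (r k *\<^sub>R \<gamma> 0) (r k *\<^sub>R \<eta> 0) \<bullet> (r k *\<^sub>R \<eta> 0)
        + G k (r k *\<^sub>R \<gamma> 0) \<bullet> (- (r k *\<^sub>R \<gamma> 0)))) =
       (\<Sum>k\<in>I. c k * ((r k)\<^sup>2 * (H k (r k *\<^sub>R \<sigma>) \<tau> \<bullet> \<tau>) - r k * (G k (r k *\<^sub>R \<sigma>) \<bullet> \<sigma>)))"
    proof (rule sum.cong[OF refl])
      fix k assume k: "k \<in> I"
      have "linear (H k (r k *\<^sub>R \<sigma>))" using solD(4)[OF u[OF k], of "r k *\<^sub>R \<sigma>"] r[OF k] \<sigma> by simp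
      then show "c k * (H k (r k *\<^sub>R \<gamma> 0) (r k *\<^sub>R \<eta> 0) \<bullet> (r k *\<^sub>R \<eta> 0) + G k (r k *\<^sub>R \<gamma> 0) \<bullet> (- (r k *\<^sub>R \<gamma> 0))) =
         c k * ((r k)\<^sup>2 * (H k (r k *\<^sub>R \<sigma>) \<tau> \<bullet> \<tau>) - r k * (G k (r k *\<^sub>R \<sigma>) \<bullet> \<sigma>))"
        by (simp add: \<gamma>_def \<eta>_def linear_scale power2_eq_square)
    qed
    finally show ?thesis .
  qed
  have *: "c k * (r k)\<^sup>2 * (f (u k (r k *\<^sub>R \<sigma>)) - radlap (G k) (H k) (r k) \<sigma>) =
     (\<Sum>\<tau>\<in>S - {\<sigma>}. c k * ((r k)\<^sup>2 * (H k (r k *\<^sub>R \<sigma>) \<tau> \<bullet> \<tau>) - r k * (G k (r k *\<^sub>R \<sigma>) \<bullet> \<sigma>)))"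
    if k: "k \<in> I" for k
  proof -
    have n: "norm (r k *\<^sub>R \<sigma>) < 1" using r[OF k] \<sigma> by simp
    have "f (u k (r k *\<^sub>R \<sigma>)) = (\<Sum>s\<in>S. H k (r k *\<^sub>R \<sigma>) s \<bullet> s)"
      using solD(3,4)[OF u[OF k] n] trace_orthonormal[OF _ S(2,3,6) fin] by metis
    also have "\<dots> = H k (r k *\<^sub>R \<sigma>) \<sigma> \<bullet> \<sigma> + (\<Sum>s\<in>S - {\<sigma>}. H k (r k *\<^sub>R \<sigma>) s \<bullet> s)"
      using fin S(1) by (simp add: sum.remove)
    finally have 1: "(\<Sum>s\<in>S - {\<sigma>}. H k (r k *\<^sub>R \<sigma>) s \<bullet> s) = f (u k (r k *\<^sub>R \<sigma>)) - H k (r k *\<^sub>R \<sigma>) \<sigma> \<bullet> \<sigma>" by simp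
    have card: "real (card (S - {\<sigma>})) = real DIM('a) - 1"
      using fin S(1,5) by (simp add: of_nat_diff Suc_leI DIM_positive)
    show ?thesis
      using r[OF k]
      by (simp add: sum_distrib_left[symmetric] sum_subtractf 1 card[simplified] radlap_def)
        (simp add: card field_simps power2_eq_square)
  qed
  have "(\<Sum>k\<in>I. c k * (r k)\<^sup>2 * (f (u k (r k *\<^sub>R \<sigma>)) - radlap (G k) (H k) (r k) \<sigma>)) =
     (\<Sum>\<tau>\<in>S - {\<sigma>}. \<Sum>k\<in>I. c k * ((r k)\<^sup>2 * (H k (r k *\<^sub>R \<sigma>) \<tau> \<bullet> \<tau>) - r k * (G k (r k *\<^sub>R \<sigma>) \<bullet> \<sigma>)))"
    by (subst sum.swap) (simp add: *)
  also have "\<dots> \<le> 0" by (intro sum_nonpos tan)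
  finally show ?thesis .
qed

lemma spherical_max_single:
  assumes u: "blowup_solution f u G H" and r: "0 < r" "r < 1" and \<sigma>: "norm \<sigma> = 1"
  shows "(\<And>\<sigma>'. norm \<sigma>' = 1 \<Longrightarrow> u (r *\<^sub>R \<sigma>') \<le> u (r *\<^sub>R \<sigma>)) \<Longrightarrow> f (u (r *\<^sub>R \<sigma>)) \<le> radlap G H r \<sigma>"
    and "(\<And>\<sigma>'. norm \<sigma>' = 1 \<Longrightarrow> u (r *\<^sub>R \<sigma>) \<le> u (r *\<^sub>R \<sigma>')) \<Longrightarrow> radlap G H r \<sigma> \<le> f (u (r *\<^sub>R \<sigma>))"
  using spherical_max[of "{()}" f "\<lambda>_. u" "\<lambda>_. G" "\<lambda>_. H" "\<lambda>_. r" \<sigma> "\<lambda>_. 1"]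
    spherical_max[of "{()}" f "\<lambda>_. u" "\<lambda>_. G" "\<lambda>_. H" "\<lambda>_. r" \<sigma> "\<lambda>_. - 1"] assms
  by (auto simp: mult_le_0_iff zero_le_mult_iff)

lemma spherical_max_diff:
  assumes u: "blowup_solution f u G H" and v: "blowup_solution f v G' H'" and r: "0 < r" "r < 1" and \<sigma>: "norm \<sigma> = 1"
    and max: "\<And>\<sigma>'. norm \<sigma>' = 1 \<Longrightarrow> u (r *\<^sub>R \<sigma>') - v (r *\<^sub>R \<sigma>') \<le> u (r *\<^sub>R \<sigma>) - v (r *\<^sub>R \<sigma>)"
  shows "f (u (r *\<^sub>R \<sigma>)) - f (v (r *\<^sub>R \<sigma>)) \<le> radlap G H r \<sigma> - radlap G' H' r \<sigma>"
proof -
  have "(\<Sum>k\<in>(UNIV::bool set). (if k then 1 else - 1) * r\<^sup>2 * (f ((if k then u else v) (r *\<^sub>R \<sigma>))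
      - radlap (if k then G else G') (if k then H else H') r \<sigma>)) \<le> 0"
    by (rule spherical_max) (use assms in \<open>auto simp: UNIV_bool\<close>)
  then have "r\<^sup>2 * ((f (u (r *\<^sub>R \<sigma>)) - f (v (r *\<^sub>R \<sigma>))) - (radlap G H r \<sigma> - radlap G' H' r \<sigma>)) \<le> 0"
    by (simp add: UNIV_bool algebra_simps)
  then show ?thesis using r by (simp add: mult_le_0_iff)
qed

text \<open>The trace does not change under an orthonormal change of basis, so \<Delta>(u \<circ> R)
  = (\<Delta>u) \<circ> R. Having \<open>G\<close> and \<open>H\<close> as explicit parameters of
  \<open>blowup_solution\<close> means the rotated solution comes with its derivatives in closed
  form.\<close>

lemma sol_rotate:
  fixes u :: "'a::euclidean_space \<Rightarrow> real" and R :: "'a \<Rightarrow> 'a"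
  assumes u: "blowup_solution f u G H" and R: "orthogonal_transformation R"
  shows "blowup_solution f (\<lambda>x. u (R x)) (\<lambda>x. adjoint R (G (R x))) (\<lambda>x h. adjoint R (H (R x) (R h)))"
  unfolding blowup_solution_def
proof (intro conjI ballI allI)
  have lin: "linear R" and nR: "norm (R x) = norm x" for x
    using R by (auto simp: orthogonal_transformation orthogonal_transformation_linear)
  have dR: "(R has_derivative R) (at x)" for x
    using lin by (simp add: linear_imp_has_derivative)
  have dA: "(adjoint R has_derivative adjoint R) (at x)" for x
    using adjoint_linear[OF lin] by (simp add: linear_imp_has_derivative)
  fix x :: 'a assume "x \<in> ball 0 1"
  then have n: "norm (R x) < 1" by (simp add: nR)
  note D = solD[OF u n]
  show "((\<lambda>x. u (R x)) has_derivative (\<bullet>) (adjoint R (G (R x)))) (at x)"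
    by (rule has_derivative_eq_rhs[OF has_derivative_compose[OF dR D(1)]])
      (simp add: fun_eq_iff adjoint_clauses[OF lin])
  show "((\<lambda>x. adjoint R (G (R x))) has_derivative (\<lambda>h. adjoint R (H (R x) (R h)))) (at x)"
    using has_derivative_compose[OF has_derivative_compose[OF dR D(2)] dA] .
  have "(\<Sum>b\<in>Basis. adjoint R (H (R x) (R b)) \<bullet> b) = (\<Sum>b\<in>Basis. H (R x) (R b) \<bullet> R b)"
    by (simp add: adjoint_clauses[OF lin])
  also have "\<dots> = (\<Sum>s\<in>R ` Basis. H (R x) s \<bullet> s)"
    by (subst sum.reindex) (auto intro: inj_on_subset[OF orthogonal_transformation_inj[OF R]])
  also have "\<dots> = (\<Sum>b\<in>Basis. H (R x) b \<bullet> b)"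
  proof (rule trace_orthonormal[OF D(4)])
    show "pairwise orthogonal (R ` Basis)"
      using R by (auto simp: pairwise_def orthogonal_def orthogonal_transformation_def inner_Basis)
    show "span (R ` Basis) = UNIV"
      using orthogonal_transformation_surj[OF R] by (simp add: linear_span_image[OF lin])
  qed (auto simp: nR)
  finally show "(\<Sum>b\<in>Basis. adjoint R (H (R x) (R b)) \<bullet> b) = f (u (R x))" using D(3) by simp
next
  fix c
  obtain r where "r < 1" "\<And>x. r \<le> norm x \<Longrightarrow> norm x < 1 \<Longrightarrow> c \<le> u x" using sol_blowup[OF u] by metis
  then show "\<exists>r<1. \<forall>x. r \<le> norm x \<longrightarrow> norm x < 1 \<longrightarrow> c \<le> u (R x)"
    using R by (auto simp: orthogonal_transformation)
qed

section \<open>Rotations as products of two reflections\<close>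

definition hrefl :: "'a::euclidean_space \<Rightarrow> 'a \<Rightarrow> 'a" where
  "hrefl n x = x - (2 * (x \<bullet> n)) *\<^sub>R n"

lemma hrefl_orthogonal: "norm n = 1 \<Longrightarrow> orthogonal_transformation (hrefl n)"
  unfolding orthogonal_transformation_def hrefl_def
  by (auto intro!: linearI simp: norm_eq_1 algebra_simps inner_commute)

text \<open>The product of two reflections is a rotation by twice the angle between their unit
  normals. Since \<open>hrefl n\<close> is an involution, the displacement of \<open>x\<close> is
  the difference of two reflections of the same vector \<open>hrefl n x\<close>, hence linear in |m
  - n|.\<close>

lemma hrefl_diff:
  assumes "norm m = 1" "norm n = 1"
  shows "norm (hrefl m (hrefl n x) - x) \<le> 4 * norm (m - n) * norm x"
proof -
  define y where "y = hrefl n x"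
  have ny: "norm y = norm x"
    using hrefl_orthogonal[OF assms(2)] by (simp add: y_def orthogonal_transformation)
  have "x = hrefl n y" using assms(2) by (simp add: y_def hrefl_def norm_eq_1 algebra_simps)
  then have "hrefl m (hrefl n x) - x = hrefl m y - hrefl n y" by (metis y_def)
  also have "\<dots> = 2 *\<^sub>R ((y \<bullet> (n - m)) *\<^sub>R n + (y \<bullet> m) *\<^sub>R (n - m))"
    by (simp add: hrefl_def inner_diff_right scaleR_add_right scaleR_diff_right scaleR_diff_left algebra_simps)
  also have "norm \<dots> \<le> 2 * (\<bar>y \<bullet> (n - m)\<bar> * norm n + \<bar>y \<bullet> m\<bar> * norm (n - m))"
    using norm_triangle_ineq[of "(y \<bullet> (n - m)) *\<^sub>R n" "(y \<bullet> m) *\<^sub>R (n - m)"] by simp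
  also have "\<dots> \<le> 2 * (norm y * norm (n - m) * norm n + norm y * norm m * norm (n - m))"
    by (intro mult_left_mono add_mono mult_right_mono Cauchy_Schwarz_ineq2) auto
  finally show ?thesis using assms by (simp add: ny norm_minus_commute mult.commute)
qed

section \<open>The radial comparison\<close>

text \<open>\<open>\<rho>\<close> inverts the radial fundamental solution: \<open>\<tau> = log r\<close> for \<open>N = 2\<close> and \<open>\<tau> = (r\<^sup>2\<^sup>-\<^sup>N - 1) / (2 - N)\<close> otherwise.\<close>

lemma radial_coordinate_exists:
  fixes N :: nat
  assumes "N \<ge> 1"
  obtains \<rho> :: "real \<Rightarrow> real" where "\<rho> 0 = 1" "\<And>\<tau>. - 1/2 \<le> \<tau> \<Longrightarrow> \<tau> \<le> 0 \<Longrightarrow> 0 < \<rho> \<tau>"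
    "\<And>\<tau>. - 1/2 \<le> \<tau> \<Longrightarrow> \<tau> \<le> 0 \<Longrightarrow> (\<rho> has_real_derivative \<rho> \<tau> ^ (N - 1)) (at \<tau>)"
proof (cases "N = 2")
  case True
  then show ?thesis by (intro that[of exp]) (auto intro!: derivative_eq_intros)
next
  case False
  define c :: real where "c = 2 - real N"
  have c: "c \<noteq> 0" "c \<le> 1" using False assms by (auto simp: c_def)
  \<comment> \<open>The lower end of the range matters only for N = 1, the one case with c > 0:
    there 1 + \<tau> has to stay positive. For N > 2 the quantity is at least 1.\<close>
  have p: "1 + c * \<tau> > 0" if "- 1/2 \<le> \<tau>" "\<tau> \<le> 0" for \<tau>
  proof (cases "c > 0")
    case True
    then have "c * (- 1/2) \<le> c * \<tau>" using that by (intro mult_left_mono) auto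
    then show ?thesis using c by linarith
  next
    case False
    then have "c * \<tau> \<ge> 0" using that by (simp add: zero_le_mult_iff)
    then show ?thesis by linarith
  qed
  show ?thesis
  proof (rule that[of "\<lambda>\<tau>. (1 + c * \<tau>) powr (1 / c)"])
    fix \<tau> :: real assume t: "- 1/2 \<le> \<tau>" "\<tau> \<le> 0"
    show "0 < (1 + c * \<tau>) powr (1 / c)" using p[OF t] by simp
    have "((1 + c * \<tau>) powr (1 / c)) ^ (N - 1) = (1 + c * \<tau>) powr (1 / c * real (N - 1))"
      using p[OF t] by (simp add: powr_powr powr_realpow[symmetric])
    also have "1 / c * real (N - 1) = 1 / c - 1"
      using c(1) assms by (simp add: c_def field_simps of_nat_diff)
    finally have "((1 + c * \<tau>) powr (1 / c)) ^ (N - 1) = (1 + c * \<tau>) powr (1 / c - 1)" .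
    then show "((\<lambda>\<tau>. (1 + c * \<tau>) powr (1 / c)) has_real_derivative ((1 + c * \<tau>) powr (1 / c)) ^ (N - 1)) (at \<tau>)"
      using p[OF t] c by (auto intro!: derivative_eq_intros)
  qed auto
qed

section \<open>Monotonicity and distortion of the radial coordinate\<close>

locale radial_coordinate =
  fixes \<rho> :: "real \<Rightarrow> real" and N :: nat
  assumes N: "N \<ge> 1" and rho_0: "\<rho> 0 = 1"
    and rho_pos: "\<And>\<tau>. - 1/2 \<le> \<tau> \<Longrightarrow> \<tau> \<le> 0 \<Longrightarrow> 0 < \<rho> \<tau>"
    and rho_deriv: "\<And>\<tau>. - 1/2 \<le> \<tau> \<Longrightarrow> \<tau> \<le> 0 \<Longrightarrow> (\<rho> has_real_derivative \<rho> \<tau> ^ (N - 1)) (at \<tau>)"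
begin

lemma rho_strict_mono:
  assumes "- 1/2 \<le> s" "s < t" "t \<le> 0"
  shows "\<rho> s < \<rho> t"
proof (rule DERIV_pos_imp_increasing[OF assms(2)])
  fix x assume "s \<le> x" "x \<le> t"
  then have "- 1/2 \<le> x" "x \<le> 0" using assms by auto
  from rho_deriv[OF this] rho_pos[OF this]
  show "\<exists>y. (\<rho> has_real_derivative y) (at x) \<and> 0 < y" by (intro exI[of _ "\<rho> x ^ (N - 1)"]) simp
qed

lemma rho_mono:
  assumes "- 1/2 \<le> s" "s \<le> t" "t \<le> 0"
  shows "\<rho> s \<le> \<rho> t"
  using rho_strict_mono[of s t] assms by (cases "s = t") auto

lemma rho_less_1: "- 1/2 \<le> \<tau> \<Longrightarrow> \<tau> < 0 \<Longrightarrow> \<rho> \<tau> < 1"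
  using rho_strict_mono[of \<tau> 0] rho_0 by simp

lemma rho_le_1: "- 1/2 \<le> \<tau> \<Longrightarrow> \<tau> \<le> 0 \<Longrightarrow> \<rho> \<tau> \<le> 1"
  using rho_mono[of \<tau> 0] rho_0 by simp

lemma rho_continuous: "continuous_on {- 1/2..0} \<rho>"
  by (intro continuous_at_imp_continuous_on ballI DERIV_isCont[OF rho_deriv]) auto

lemma rho_near_1:
  assumes "r < 1"
  obtains \<tau> where "- 1/2 < \<tau>" "\<tau> < 0" "r \<le> \<rho> \<tau>"
proof -
  define s where "s = max r (\<rho> (- 1/4))"
  have s: "s < 1" using assms rho_less_1[of "-1/4"] by (simp add: s_def)
  have "\<exists>x. - 1/4 \<le> x \<and> x \<le> 0 \<and> \<rho> x = s"
    by (intro IVT' continuous_on_subset[OF rho_continuous]) (use s rho_0 in \<open>auto simp: s_def\<close>)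
  then obtain x where x: "- 1/4 \<le> x" "x \<le> 0" "\<rho> x = s" by blast
  then have "x \<noteq> 0" using s rho_0 by auto
  with x show ?thesis by (intro that[of x]) (auto simp: s_def)
qed

lemma rho_surj:
  assumes "- 1/2 \<le> \<tau>0" "\<tau>0 < 0" "\<rho> \<tau>0 \<le> r" "r < 1"
  obtains \<tau> where "\<tau>0 \<le> \<tau>" "\<tau> < 0" "\<rho> \<tau> = r"
proof -
  have "\<exists>x. \<tau>0 \<le> x \<and> x \<le> 0 \<and> \<rho> x = r"
    by (intro IVT' continuous_on_subset[OF rho_continuous]) (use assms rho_0 in \<open>auto\<close>)
  then obtain x where x: "\<tau>0 \<le> x" "x \<le> 0" "\<rho> x = r" by blast
  then have "x \<noteq> 0" using assms rho_0 by auto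
  with x show ?thesis by (intro that[of x]) auto
qed

text \<open>Converts a rate in the coordinate, \<open>- \<tau>\<close>, into the distance
  \<open>1 - r\<close> to the boundary; the derivative of \<open>\<rho>\<close> is bounded below by
  its value at the left end.\<close>

lemma rho_dist:
  assumes "- 1/2 \<le> \<tau>" "\<tau> < 0"
  shows "- \<tau> * \<rho> (- 1/2) ^ (N - 1) \<le> 1 - \<rho> \<tau>"
proof -
  have "\<exists>z>\<tau>. z < 0 \<and> \<rho> 0 - \<rho> \<tau> = (0 - \<tau>) * \<rho> z ^ (N - 1)"
    using assms by (intro MVT2 rho_deriv) auto
  then obtain z where z: "\<tau> < z" "z < 0" "1 - \<rho> \<tau> = - \<tau> * \<rho> z ^ (N - 1)" using rho_0 by auto
  have "\<rho> (- 1/2) ^ (N - 1) \<le> \<rho> z ^ (N - 1)"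
    using z assms rho_pos[of "-1/2"] by (intro power_mono rho_mono) auto
  then show ?thesis unfolding z(3) using assms by (intro mult_left_mono) auto
qed

lemma rho_power_deriv:
  assumes "- 1/2 \<le> \<tau>" "\<tau> \<le> 0"
  shows "((\<lambda>\<tau>. \<rho> \<tau> ^ (N - 1)) has_real_derivative (real N - 1) / \<rho> \<tau> * (\<rho> \<tau> ^ (N - 1))\<^sup>2) (at \<tau>)"
proof -
  have "((\<lambda>\<tau>. \<rho> \<tau> ^ (N - 1)) has_real_derivative of_nat (N - 1) * (\<rho> \<tau> ^ (N - 1) * \<rho> \<tau> ^ (N - 1 - Suc 0))) (at \<tau>)"
    by (rule DERIV_power[OF rho_deriv[OF assms]])
  moreover have "of_nat (N - 1) * (\<rho> \<tau> ^ (N - 1) * \<rho> \<tau> ^ (N - 1 - Suc 0)) = (real N - 1) / \<rho> \<tau> * (\<rho> \<tau> ^ (N - 1))\<^sup>2"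
    using N rho_pos[OF assms] by (cases "N - 1") (auto simp: of_nat_diff power2_eq_square nat_eq_iff)
  ultimately show ?thesis by simp
qed

text \<open>The logarithmic derivative of \<rho>^(N-1) is (N-1) \<rho>^(N-2), at most N for N > 1
  since \<rho> \<le> 1, and zero for N = 1. When the coordinate is shifted, this lets the chain-rule
  factor of the contraction absorb the change of the metric factor.\<close>

lemma rho_power_growth:
  assumes "- 1/2 \<le> s" "s < t" "t \<le> 0"
  shows "\<rho> t ^ (N - 1) * (1 - real N * (t - s)) \<le> \<rho> s ^ (N - 1)"
proof -
  have "\<exists>z>s. z < t \<and> \<rho> t ^ (N - 1) - \<rho> s ^ (N - 1) = (t - s) * ((real N - 1) / \<rho> z * (\<rho> z ^ (N - 1))\<^sup>2)"
    using assms by (intro MVT2 rho_power_deriv) auto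
  then obtain z where z: "s < z" "z < t"
    "\<rho> t ^ (N - 1) - \<rho> s ^ (N - 1) = (t - s) * ((real N - 1) / \<rho> z * (\<rho> z ^ (N - 1))\<^sup>2)" by blast
  have rz: "0 < \<rho> z" "\<rho> z \<le> 1" using z assms rho_pos[of z] rho_le_1[of z] by auto
  have "(real N - 1) / \<rho> z * (\<rho> z ^ (N - 1))\<^sup>2 \<le> real N * \<rho> z ^ (N - 1)"
  proof (cases "N = 1")
    case False
    then obtain k where k: "N = Suc (Suc k)" using N by (metis One_nat_def Suc_le_D not0_implies_Suc)
    have "(real N - 1) / \<rho> z * (\<rho> z ^ (N - 1))\<^sup>2 = (real N - 1) * (\<rho> z ^ k * \<rho> z ^ (N - 1))"
      using rz by (simp add: k power2_eq_square)
    also have "\<dots> \<le> real N * (1 * \<rho> z ^ (N - 1))"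
      using rz N by (intro mult_mono power_le_one) auto
    finally show ?thesis by simp
  qed (use rz in auto)
  also have "\<dots> \<le> real N * \<rho> t ^ (N - 1)"
    using z assms rz by (intro mult_left_mono power_mono rho_mono) auto
  finally have "\<rho> t ^ (N - 1) - \<rho> s ^ (N - 1) \<le> (t - s) * (real N * \<rho> t ^ (N - 1))"
    unfolding z(3) using assms by (intro mult_left_mono) auto
  then show ?thesis by (simp add: algebra_simps)
qed

text \<open>The relation \<rho>'' = ((N-1) / \<rho>) (\<rho>')^2 is exactly what turns the
  chain-rule term with \<rho>'' into the first-order part of \<open>radlap\<close>.\<close>

lemma sol_radial:
  fixes u :: "'a::euclidean_space \<Rightarrow> real"
  assumes u: "blowup_solution f u G H" and \<tau>: "- 1/2 < \<tau>" "\<tau> < 0" and \<sigma>: "norm \<sigma> = 1" and dim: "N = DIM('a)"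
  shows "((\<lambda>\<tau>. u (\<rho> \<tau> *\<^sub>R \<sigma>)) has_real_derivative (G (\<rho> \<tau> *\<^sub>R \<sigma>) \<bullet> \<sigma>) * \<rho> \<tau> ^ (N - 1)) (at \<tau>)"
    and "((\<lambda>\<tau>. (G (\<rho> \<tau> *\<^sub>R \<sigma>) \<bullet> \<sigma>) * \<rho> \<tau> ^ (N - 1)) has_real_derivative
      (\<rho> \<tau> ^ (N - 1))\<^sup>2 * radlap G H (\<rho> \<tau>) \<sigma>) (at \<tau>)"
proof -
  have r: "0 < \<rho> \<tau>" "\<rho> \<tau> < 1" using \<tau> rho_pos[of \<tau>] rho_less_1[of \<tau>] by auto
  have n: "norm (\<rho> \<tau> *\<^sub>R \<sigma>) < 1" using r \<sigma> by simp
  have d: "((\<lambda>\<tau>. \<rho> \<tau> *\<^sub>R \<sigma>) has_vector_derivative (\<rho> \<tau> ^ (N - 1)) *\<^sub>R \<sigma>) (at \<tau>)"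
    using \<tau> rho_deriv[of \<tau>] by (auto intro!: derivative_eq_intros)
  show "((\<lambda>\<tau>. u (\<rho> \<tau> *\<^sub>R \<sigma>)) has_real_derivative (G (\<rho> \<tau> *\<^sub>R \<sigma>) \<bullet> \<sigma>) * \<rho> \<tau> ^ (N - 1)) (at \<tau>)"
    using sol_curve(1)[OF u n d] by (simp add: mult.commute)
  have "((\<lambda>\<tau>. G (\<rho> \<tau> *\<^sub>R \<sigma>) \<bullet> \<sigma>) has_real_derivative H (\<rho> \<tau> *\<^sub>R \<sigma>) (\<rho> \<tau> ^ (N - 1) *\<^sub>R \<sigma>) \<bullet> \<sigma> + G (\<rho> \<tau> *\<^sub>R \<sigma>) \<bullet> 0) (at \<tau>)"
    by (rule sol_curve(2)[OF u n d]) simp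
  then have *: "((\<lambda>\<tau>. G (\<rho> \<tau> *\<^sub>R \<sigma>) \<bullet> \<sigma>) has_real_derivative \<rho> \<tau> ^ (N - 1) * (H (\<rho> \<tau> *\<^sub>R \<sigma>) \<sigma> \<bullet> \<sigma>)) (at \<tau>)"
    using solD(4)[OF u n] by (simp add: linear_scale)
  have p: "((\<lambda>\<tau>. \<rho> \<tau> ^ (N - 1)) has_real_derivative (real N - 1) / \<rho> \<tau> * (\<rho> \<tau> ^ (N - 1))\<^sup>2) (at \<tau>)"
    using \<tau> by (intro rho_power_deriv) auto
  from DERIV_mult[OF * p]
  show "((\<lambda>\<tau>. (G (\<rho> \<tau> *\<^sub>R \<sigma>) \<bullet> \<sigma>) * \<rho> \<tau> ^ (N - 1)) has_real_derivative
      (\<rho> \<tau> ^ (N - 1))\<^sup>2 * radlap G H (\<rho> \<tau>) \<sigma>) (at \<tau>)"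
    by (rule DERIV_cong) (use \<tau> in \<open>auto simp: radlap_def dim algebra_simps power2_eq_square\<close>)
qed

end

section \<open>Boundary comparison against a concave barrier\<close>

locale comparison = radial_coordinate +
  fixes f :: "real \<Rightarrow> real" and K a :: real
  assumes K: "K \<ge> 0" and one_sided_lipschitz: "\<And>s t. t \<le> s \<Longrightarrow> - K * (s - t) \<le> f s - f t"
    and f_nonneg: "\<And>t. t > a \<Longrightarrow> f t \<ge> 0"
begin

text \<open>The value \<open>b'' = - 2 (K + 1)\<close> makes \<open>b\<close> a strict supersolution of \<open>\<Delta>b = - K b\<close> on \<open>[T, 0)\<close>, where \<open>0 < b \<le> 1\<close>.\<close>

definition b :: "real \<Rightarrow> real" where "b \<tau> = - \<tau> - (K + 1) * \<tau>\<^sup>2"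

text \<open>Two smallness conditions meet here. \<open>(K + 1) * - T \<le> 1/2\<close> keeps
  \<open>b \<tau>\<close> at least \<open>- \<tau> / 2\<close> on [T, 0);
  \<open>real N * - T \<le> 1/2\<close> keeps the shift \<open>\<phi> \<tau> - \<tau>\<close> of the
  contracted coordinate at most \<delta> / N there.\<close>

definition T :: real where "T = - 1 / (2 * (real N + K + 1))"

lemma T: "- 1/4 \<le> T" "T < 0" "real N * - T \<le> 1/2" "(K + 1) * - T \<le> 1/2"
  using K N by (auto simp: T_def field_simps)

lemma b_bounds:
  assumes "T \<le> \<tau>" "\<tau> < 0"
  shows "- \<tau> / 2 \<le> b \<tau>" "b \<tau> \<le> - \<tau>" "0 < b \<tau>" "b \<tau> \<le> 1"
proof -
  have "(K + 1) * - \<tau> \<le> (K + 1) * - T" using assms K by (intro mult_left_mono) auto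
  then have "(K + 1) * - \<tau> \<le> 1/2" using T by linarith
  then have "((K + 1) * - \<tau>) * - \<tau> \<le> 1/2 * - \<tau>" using assms by (intro mult_right_mono) auto
  then show 1: "- \<tau> / 2 \<le> b \<tau>" by (simp add: b_def power2_eq_square)
  show 2: "b \<tau> \<le> - \<tau>" using K by (simp add: b_def)
  show "0 < b \<tau>" "b \<tau> \<le> 1" using 1 2 assms T by linarith+
qed

lemma b_continuous: "continuous_on A b"
  unfolding b_def by (intro continuous_intros)

lemma b_deriv: "(b has_real_derivative - 1 - 2 * (K + 1) * \<tau>) (at \<tau>)"
  unfolding b_def by (auto intro!: derivative_eq_intros)

text \<open>\<open>\<phi>\<close> reaches \<open>0\<close> before \<open>\<tau>\<close> does, so \<open>v (\<rho> (\<phi> \<tau>) \<sigma>')\<close> blows up first and the quotient of the difference by \<open>b\<close> attains its supremum.\<close>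

lemma diff_shift_le:
  fixes u v :: "'a::euclidean_space \<Rightarrow> real"
  assumes u: "blowup_solution f u G H" and v: "blowup_solution f v G' H'" and dim: "N = DIM('a)"
    and t0: "T \<le> \<tau>0" "\<tau>0 < 0"
    and va: "\<And>x. \<rho> \<tau>0 \<le> norm x \<Longrightarrow> norm x < 1 \<Longrightarrow> a < v x"
    and C: "0 \<le> C" "\<And>\<sigma>. norm \<sigma> = 1 \<Longrightarrow> u (\<rho> \<tau>0 *\<^sub>R \<sigma>) - a \<le> C * b \<tau>0"
    and \<delta>: "0 < \<delta>" "\<delta> < 1"
    and \<phi>_def: "\<phi> = (\<lambda>\<tau>. (1 - \<delta>) * \<tau> + \<delta> / (2 * real N))"
    and t: "\<tau>0 \<le> \<tau>" "\<phi> \<tau> < 0" and \<sigma>: "norm \<sigma> = 1" "norm \<sigma>' = 1"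
  shows "u (\<rho> \<tau> *\<^sub>R \<sigma>) - v (\<rho> (\<phi> \<tau>) *\<^sub>R \<sigma>') \<le> C * b \<tau>"
proof (rule ccontr)
  assume contra: "\<not> ?thesis"
  define e where "e = \<delta> / (2 * real N)"
  have e: "e > 0" using \<delta> N by (simp add: e_def)
  have phi: "\<phi> s = (1 - \<delta>) * s + e" for s by (simp add: \<phi>_def e_def)
  define ts where "ts = - e / (1 - \<delta>)"
  have phi_neg: "\<phi> s < 0 \<longleftrightarrow> s < ts" for s using \<delta> by (auto simp: phi ts_def field_simps)
  have ts0: "ts < 0" using e \<delta> by (simp add: ts_def)
  have phi_gt: "s < \<phi> s" if "s < 0" for s
    using mult_pos_neg[OF \<delta>(1) that] e by (simp add: phi algebra_simps)
  have t_ts: "\<tau> < ts" using t(2) phi_neg by simp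
  have T4: "- 1/4 \<le> \<tau>0" using T t0 by simp
  have rts: "0 < \<rho> ts" "\<rho> ts < 1" using ts0 t_ts t T4 rho_pos[of ts] rho_less_1[of ts] by auto
  have "compact (u ` cball 0 (\<rho> ts))"
    using rts by (intro compact_continuous_image continuous_on_subset[OF sol_continuous(1)[OF u]]) auto
  then obtain Mu where Mu: "\<And>x. norm x \<le> \<rho> ts \<Longrightarrow> u x \<le> Mu"
    using compact_imp_bounded bounded_real by (metis abs_le_iff image_eqI mem_cball_0)
  obtain r' where r': "r' < 1" "\<And>x. r' \<le> norm x \<Longrightarrow> norm x < 1 \<Longrightarrow> Mu \<le> v x"
    using sol_blowup[OF v, of Mu] by blast
  obtain t2 where t2: "- 1/2 < t2" "t2 < 0" "r' \<le> \<rho> t2" using rho_near_1[OF r'(1)] by blast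
  \<comment> \<open>At \<open>te\<close> the argument of \<open>v\<close> is so close to the
    boundary that \<open>v\<close> is at least \<open>Mu\<close>, a bound for \<open>u\<close> on
    the whole range up to \<open>ts\<close>. Hence the quotient is nonpositive at this end. The
    maximum with \<open>\<tau>\<close> keeps the point of the assumed violation inside the
    interval.\<close>
  define te where "te = max \<tau> ((t2 - e) / (1 - \<delta>))"
  have phi_te: "\<phi> te = max (\<phi> \<tau>) t2"
  proof -
    have "\<phi> ((t2 - e) / (1 - \<delta>)) = t2" using \<delta> by (simp add: phi)
    moreover have "mono \<phi>" using \<delta> by (auto simp: phi mono_def intro: mult_left_mono)
    ultimately show ?thesis using max_of_mono[of \<phi> \<tau> "(t2 - e) / (1 - \<delta>)"] by (simp add: te_def)
  qed
  have te: "\<tau> \<le> te" "te < ts" "t2 \<le> \<phi> te" "\<phi> te < 0"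
    using phi_te t t2 phi_neg[of te] by (auto simp: te_def)
  have rng: "- 1/2 < s" "s < 0" "T \<le> s" "- 1/2 < \<phi> s" "\<phi> s < 0" "s < \<phi> s" "\<tau>0 \<le> \<phi> s"
    if "\<tau>0 \<le> s" "s \<le> te" for s
  proof -
    show s: "- 1/2 < s" "s < 0" "T \<le> s" using that T4 te ts0 t0 by auto
    show "s < \<phi> s" using phi_gt s by simp
    then show "- 1/2 < \<phi> s" "\<tau>0 \<le> \<phi> s" using s that by auto
    show "\<phi> s < 0" using phi_neg that te by simp
  qed
  have r1: "0 < \<rho> s" "\<rho> s < 1" "0 < \<rho> (\<phi> s)" "\<rho> (\<phi> s) < 1" "\<rho> \<tau>0 \<le> \<rho> (\<phi> s)" "\<rho> s \<le> \<rho> ts"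
    if "\<tau>0 \<le> s" "s \<le> te" for s
    using rng[OF that] T4 te ts0 that rho_pos[of s] rho_less_1[of s] rho_pos[of "\<phi> s"] rho_less_1[of "\<phi> s"]
      rho_mono[of \<tau>0 "\<phi> s"] rho_mono[of s ts] by auto
  define Z where "Z = {\<tau>0..te} \<times> sphere (0::'a) 1 \<times> sphere (0::'a) 1"
  define h where "h = (\<lambda>(s, \<sigma>, \<sigma>'). (u (\<rho> s *\<^sub>R \<sigma>) - v (\<rho> (\<phi> s) *\<^sub>R \<sigma>')) / b s)"
  have contphi: "continuous_on A \<phi>" for A unfolding phi by (intro continuous_intros)
  have b1: "b s > 0" if "\<tau>0 \<le> s" "s \<le> te" for s using b_bounds(3)[of s] rng[OF that] by simp
  have Zx: "\<tau>0 \<le> fst x" "fst x \<le> te" "norm (fst (snd x)) = 1" "norm (snd (snd x)) = 1"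
    if "x \<in> Z" for x using that by (auto simp: Z_def)
  have c1: "continuous_on Z (\<lambda>x. \<rho> (fst x))"
  proof (rule continuous_on_compose2[OF rho_continuous])
    show "fst ` Z \<subseteq> {- 1/2..0}"
    proof clarify
      fix x assume x: "x \<in> Z"
      show "fst x \<in> {- 1/2..0}" using rng(1,2)[OF Zx(1,2)[OF x]] by simp
    qed
  qed (intro continuous_intros)
  have c2: "continuous_on Z (\<lambda>x. \<rho> (\<phi> (fst x)))"
  proof (rule continuous_on_compose2[OF rho_continuous])
    show "continuous_on Z (\<lambda>x. \<phi> (fst x))"
      by (rule continuous_on_compose2[OF contphi[of UNIV]]) (auto intro: continuous_intros)
    show "(\<lambda>x. \<phi> (fst x)) ` Z \<subseteq> {- 1/2..0}"
    proof clarify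
      fix x assume x: "x \<in> Z"
      show "\<phi> (fst x) \<in> {- 1/2..0}" using rng(4,5)[OF Zx(1,2)[OF x]] by simp
    qed
  qed
  have im1: "(\<lambda>x. \<rho> (fst x) *\<^sub>R fst (snd x)) ` Z \<subseteq> ball 0 1"
  proof clarify
    fix x assume x: "x \<in> Z"
    show "\<rho> (fst x) *\<^sub>R fst (snd x) \<in> ball 0 1" using r1(1,2)[OF Zx(1,2)[OF x]] Zx(3)[OF x] by simp
  qed
  have im2: "(\<lambda>x. \<rho> (\<phi> (fst x)) *\<^sub>R snd (snd x)) ` Z \<subseteq> ball 0 1"
  proof clarify
    fix x assume x: "x \<in> Z"
    show "\<rho> (\<phi> (fst x)) *\<^sub>R snd (snd x) \<in> ball 0 1" using r1(3,4)[OF Zx(1,2)[OF x]] Zx(4)[OF x] by simp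
  qed
  have "continuous_on Z h"
    unfolding h_def split_beta
  proof (intro continuous_intros)
    show "continuous_on Z (\<lambda>x. u (\<rho> (fst x) *\<^sub>R fst (snd x)))"
      by (rule continuous_on_compose2[OF sol_continuous(1)[OF u] continuous_on_scaleR[OF c1] im1])
        (intro continuous_intros)
    show "continuous_on Z (\<lambda>x. v (\<rho> (\<phi> (fst x)) *\<^sub>R snd (snd x)))"
      by (rule continuous_on_compose2[OF sol_continuous(1)[OF v] continuous_on_scaleR[OF c2] im2])
        (intro continuous_intros)
    show "continuous_on Z (\<lambda>x. b (fst x))"
      by (rule continuous_on_compose2[OF b_continuous[of UNIV]]) (auto intro: continuous_intros)
    show "\<forall>x\<in>Z. b (fst x) \<noteq> 0"
    proof
      fix x assume x: "x \<in> Z"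
      show "b (fst x) \<noteq> 0" using b1[OF Zx(1,2)[OF x]] by simp
    qed
  qed
  moreover have "compact Z" unfolding Z_def by (intro compact_Times compact_sphere compact_Icc)
  moreover have inZ: "(\<tau>, \<sigma>, \<sigma>') \<in> Z" using t te \<sigma> by (simp add: Z_def)
  ultimately obtain z where z: "z \<in> Z" "\<And>y. y \<in> Z \<Longrightarrow> h y \<le> h z"
    using continuous_attains_sup[of Z h] by blast
  obtain t1 \<sigma>1 \<sigma>2 where z_eq: "z = (t1, \<sigma>1, \<sigma>2)" by (cases z)
  have t1: "\<tau>0 \<le> t1" "t1 \<le> te" and s1: "norm \<sigma>1 = 1" "norm \<sigma>2 = 1"
    using z(1) by (auto simp: z_eq Z_def)
  define M where "M = h z"
  have Mle: "u (\<rho> s *\<^sub>R \<alpha>) - v (\<rho> (\<phi> s) *\<^sub>R \<beta>) \<le> M * b s"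
    if "\<tau>0 \<le> s" "s \<le> te" "norm \<alpha> = 1" "norm \<beta> = 1" for s \<alpha> \<beta>
    using z(2)[of "(s, \<alpha>, \<beta>)"] that b1[of s] by (simp add: Z_def M_def h_def field_simps)
  have Meq: "u (\<rho> t1 *\<^sub>R \<sigma>1) - v (\<rho> (\<phi> t1) *\<^sub>R \<sigma>2) = M * b t1"
    using b1[OF t1] by (simp add: M_def z_eq h_def)
  have "h (\<tau>, \<sigma>, \<sigma>') > C"
    using contra b1[of \<tau>] t te by (simp add: h_def field_simps)
  then have MC: "M > C" using z(2)[OF inZ] by (simp add: M_def)
  then have M0: "M > 0" using C by simp
  have vgt: "a < v (\<rho> (\<phi> s) *\<^sub>R \<beta>)" if "\<tau>0 \<le> s" "s \<le> te" "norm \<beta> = 1" for s \<beta>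
    using va[of "\<rho> (\<phi> s) *\<^sub>R \<beta>"] r1[OF that(1,2)] that(3) by simp
  have "t1 \<noteq> \<tau>0"
  proof
    assume eq: "t1 = \<tau>0"
    have "M * b \<tau>0 \<le> C * b \<tau>0"
      using Meq C(2)[OF s1(1)] vgt[OF t1 s1(2)] unfolding eq by linarith
    then show False using b1[of \<tau>0] t te MC by simp
  qed
  moreover have "t1 \<noteq> te"
  proof
    assume eq: "t1 = te"
    have "u (\<rho> te *\<^sub>R \<sigma>1) \<le> Mu" using Mu r1[of te] s1 t1 eq by simp
    moreover have "r' \<le> \<rho> (\<phi> te)" using t2 te rho_mono[of t2 "\<phi> te"] by simp
    then have "Mu \<le> v (\<rho> (\<phi> te) *\<^sub>R \<sigma>2)" using r'(2)[of "\<rho> (\<phi> te) *\<^sub>R \<sigma>2"] r1[of te] s1 t1 eq by simp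
    ultimately have "M * b t1 \<le> 0" using Meq eq by simp
    then show False using M0 b1[OF t1] by (simp add: mult_le_0_iff)
  qed
  ultimately have t1': "\<tau>0 < t1" "t1 < te" using t1 by auto
  note R = rng[OF t1] and R1 = r1[OF t1]
  \<comment> \<open>The two sphere points vary independently, so \<open>u\<close> is maximal and
    \<open>v\<close> minimal, each on its own sphere. Separate inequalities are what is required
    here, because the two radial parts carry the different factors p^2 and ((1 - \<delta>)
    q)^2.\<close>
  have fu: "f (u (\<rho> t1 *\<^sub>R \<sigma>1)) \<le> radlap G H (\<rho> t1) \<sigma>1"
  proof (rule spherical_max_single(1)[OF u R1(1,2) s1(1)])
    fix \<alpha> :: 'a assume "norm \<alpha> = 1"
    then show "u (\<rho> t1 *\<^sub>R \<alpha>) \<le> u (\<rho> t1 *\<^sub>R \<sigma>1)" using Mle[OF t1 _ s1(2), of \<alpha>] Meq by simp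
  qed
  have fv: "radlap G' H' (\<rho> (\<phi> t1)) \<sigma>2 \<le> f (v (\<rho> (\<phi> t1) *\<^sub>R \<sigma>2))"
  proof (rule spherical_max_single(2)[OF v R1(3,4) s1(2)])
    fix \<beta> :: 'a assume "norm \<beta> = 1"
    then show "v (\<rho> (\<phi> t1) *\<^sub>R \<sigma>2) \<le> v (\<rho> (\<phi> t1) *\<^sub>R \<beta>)" using Mle[OF t1 s1(1), of \<beta>] Meq by simp
  qed
  define p q where "p = \<rho> t1 ^ (N - 1)" and "q = \<rho> (\<phi> t1) ^ (N - 1)"
  have dphi: "(\<phi> has_real_derivative (1 - \<delta>)) (at s)" for s
    unfolding \<phi>_def by (auto intro!: derivative_eq_intros)
  have "p\<^sup>2 * radlap G H (\<rho> t1) \<sigma>1 - q\<^sup>2 * radlap G' H' (\<rho> (\<phi> t1)) \<sigma>2 * (1 - \<delta>) * (1 - \<delta>)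
      - M * (- 2 * (K + 1)) \<le> 0"
  proof (rule second_derivative_at_max[where e = "min (t1 - \<tau>0) (te - t1)" and x = t1 and
      g = "\<lambda>s. u (\<rho> s *\<^sub>R \<sigma>1) - v (\<rho> (\<phi> s) *\<^sub>R \<sigma>2) - M * b s" and
      g' = "\<lambda>s. (G (\<rho> s *\<^sub>R \<sigma>1) \<bullet> \<sigma>1) * \<rho> s ^ (N - 1)
         - (G' (\<rho> (\<phi> s) *\<^sub>R \<sigma>2) \<bullet> \<sigma>2) * \<rho> (\<phi> s) ^ (N - 1) * (1 - \<delta>) - M * (- 1 - 2 * (K + 1) * s)"])
    fix s assume "\<bar>s - t1\<bar> < min (t1 - \<tau>0) (te - t1)"
    then have s: "\<tau>0 \<le> s" "s \<le> te" by auto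
    note S = rng[OF s]
    show "((\<lambda>s. u (\<rho> s *\<^sub>R \<sigma>1) - v (\<rho> (\<phi> s) *\<^sub>R \<sigma>2) - M * b s) has_real_derivative
         (G (\<rho> s *\<^sub>R \<sigma>1) \<bullet> \<sigma>1) * \<rho> s ^ (N - 1)
         - (G' (\<rho> (\<phi> s) *\<^sub>R \<sigma>2) \<bullet> \<sigma>2) * \<rho> (\<phi> s) ^ (N - 1) * (1 - \<delta>) - M * (- 1 - 2 * (K + 1) * s)) (at s)"
      by (intro DERIV_diff DERIV_cmult b_deriv sol_radial(1)[OF u S(1,2) s1(1) dim]
          DERIV_chain2[OF sol_radial(1)[OF v S(4,5) s1(2) dim] dphi])
    show "u (\<rho> s *\<^sub>R \<sigma>1) - v (\<rho> (\<phi> s) *\<^sub>R \<sigma>2) - M * b s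
       \<le> u (\<rho> t1 *\<^sub>R \<sigma>1) - v (\<rho> (\<phi> t1) *\<^sub>R \<sigma>2) - M * b t1"
      using Mle[OF s s1] Meq by simp
  next
    have "((\<lambda>s. M * (- 1 - 2 * (K + 1) * s)) has_real_derivative M * (- 2 * (K + 1))) (at t1)"
      by (auto intro!: derivative_eq_intros)
    then show "((\<lambda>s. (G (\<rho> s *\<^sub>R \<sigma>1) \<bullet> \<sigma>1) * \<rho> s ^ (N - 1)
         - (G' (\<rho> (\<phi> s) *\<^sub>R \<sigma>2) \<bullet> \<sigma>2) * \<rho> (\<phi> s) ^ (N - 1) * (1 - \<delta>) - M * (- 1 - 2 * (K + 1) * s)) has_real_derivative
       p\<^sup>2 * radlap G H (\<rho> t1) \<sigma>1 - q\<^sup>2 * radlap G' H' (\<rho> (\<phi> t1)) \<sigma>2 * (1 - \<delta>) * (1 - \<delta>)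
      - M * (- 2 * (K + 1))) (at t1)"
      unfolding p_def q_def
      by (intro DERIV_diff sol_radial(2)[OF u R(1,2) s1(1) dim] DERIV_cmult_right
          DERIV_chain2[OF sol_radial(2)[OF v R(4,5) s1(2) dim] dphi])
  qed (use t1' in auto)
  then have dd: "p\<^sup>2 * radlap G H (\<rho> t1) \<sigma>1 - ((1 - \<delta>) * q)\<^sup>2 * radlap G' H' (\<rho> (\<phi> t1)) \<sigma>2 + 2 * (K + 1) * M \<le> 0"
    by (simp add: power2_eq_square algebra_simps)
  have p: "0 < p" "p \<le> 1" and q: "0 < q" using R1 by (auto simp: p_def q_def intro!: power_le_one)
  \<comment> \<open>Half of \<delta> comes from the choice of \<open>T\<close>, the other half from
    the translation \<delta> / (2 N) in \<open>\<phi>\<close>.\<close>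
  have "real N * (\<phi> t1 - t1) \<le> \<delta>"
  proof -
    have "real N * - t1 \<le> real N * - T" using R by (intro mult_left_mono) auto
    then have "real N * - t1 \<le> 1/2" using T by simp
    then have "\<delta> * (real N * - t1) \<le> \<delta> * (1/2)" using \<delta> by (intro mult_left_mono) auto
    moreover have "real N * (\<phi> t1 - t1) = \<delta> * (real N * - t1) + \<delta> / 2" using N by (simp add: \<phi>_def field_simps)
    ultimately show ?thesis by simp
  qed
  then have "(1 - \<delta>) * q \<le> q * (1 - real N * (\<phi> t1 - t1))" using q by simp
  also have "\<dots> \<le> p" using rho_power_growth[of t1 "\<phi> t1"] R by (simp add: p_def q_def)
  finally have qp: "((1 - \<delta>) * q)\<^sup>2 \<le> p\<^sup>2" using q \<delta> by (intro power_mono) auto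
  let ?fu = "f (u (\<rho> t1 *\<^sub>R \<sigma>1))" and ?fv = "f (v (\<rho> (\<phi> t1) *\<^sub>R \<sigma>2))"
  have "((1 - \<delta>) * q)\<^sup>2 * radlap G' H' (\<rho> (\<phi> t1)) \<sigma>2 \<le> ((1 - \<delta>) * q)\<^sup>2 * ?fv"
    using fv by (intro mult_left_mono) auto
  \<comment> \<open>The sign of \<open>f\<close> above \<open>a\<close> enters here: it allows the
    smaller factor to be replaced by p^2, after which both values of \<open>f\<close> carry the same
    weight and the one-sided bound applies.\<close>
  also have "\<dots> \<le> p\<^sup>2 * ?fv" using qp f_nonneg[OF vgt[OF t1 s1(2)]] by (intro mult_right_mono) auto
  finally have 1: "((1 - \<delta>) * q)\<^sup>2 * radlap G' H' (\<rho> (\<phi> t1)) \<sigma>2 \<le> p\<^sup>2 * ?fv" .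
  have 2: "p\<^sup>2 * ?fu \<le> p\<^sup>2 * radlap G H (\<rho> t1) \<sigma>1" using fu by (intro mult_left_mono) auto
  have Mb: "0 \<le> M * b t1" "M * b t1 \<le> M" using M0 b1[OF t1] b_bounds(4)[of t1] R by auto
  have "- K * (M * b t1) \<le> ?fu - ?fv" using one_sided_lipschitz[of "v (\<rho> (\<phi> t1) *\<^sub>R \<sigma>2)" "u (\<rho> t1 *\<^sub>R \<sigma>1)"] Meq Mb by simp
  then have "p\<^sup>2 * (- K * (M * b t1)) \<le> p\<^sup>2 * (?fu - ?fv)" by (intro mult_left_mono) auto
  moreover have "p\<^sup>2 * (K * (M * b t1)) \<le> 1 * (K * M)"
    using p K Mb by (intro mult_mono power_le_one) auto
  ultimately have "- (K * M) \<le> p\<^sup>2 * (?fu - ?fv)" by simp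
  with 1 2 dd have "- (K * M) + 2 * (K + 1) * M \<le> 0" by (simp add: algebra_simps)
  moreover have "K * M \<ge> 0" using K M0 by simp
  ultimately show False using M0 by (simp add: algebra_simps)
qed

text \<open>Neither \<open>C\<close> nor \<open>\<tau>0\<close> depends on the contraction parameter
  \<delta>, so it can be sent to 0 from the right. With \<sigma> and \<sigma>' independent the
  result compares the maximum of \<open>u\<close> with the minimum of \<open>v\<close> on a sphere;
  for u = v it bounds the oscillation of a single solution.\<close>

lemma diff_le:
  fixes u v :: "'a::euclidean_space \<Rightarrow> real"
  assumes u: "blowup_solution f u G H" and v: "blowup_solution f v G' H'" and dim: "N = DIM('a)"
  obtains C \<tau>0 where "0 \<le> C" "T \<le> \<tau>0" "\<tau>0 < 0"
    "\<And>\<tau> \<sigma> \<sigma>'. \<tau>0 \<le> \<tau> \<Longrightarrow> \<tau> < 0 \<Longrightarrow> norm \<sigma> = 1 \<Longrightarrow> norm \<sigma>' = 1 \<Longrightarrow>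
      u (\<rho> \<tau> *\<^sub>R \<sigma>) - v (\<rho> \<tau> *\<^sub>R \<sigma>') \<le> C * b \<tau>"
proof -
  obtain r where r: "r < 1" "\<And>x. r \<le> norm x \<Longrightarrow> norm x < 1 \<Longrightarrow> a + 1 \<le> v x"
    using sol_blowup[OF v, of "a + 1"] by blast
  obtain t' where t': "- 1/2 < t'" "t' < 0" "r \<le> \<rho> t'" using rho_near_1[OF r(1)] by blast
  define \<tau>0 where "\<tau>0 = max t' T"
  have t0: "T \<le> \<tau>0" "\<tau>0 < 0" "- 1/4 \<le> \<tau>0" using t' T by (auto simp: \<tau>0_def)
  have "r \<le> \<rho> \<tau>0" using t' t0 rho_mono[of t' \<tau>0] by (simp add: \<tau>0_def)
  then have va: "a < v x" if "\<rho> \<tau>0 \<le> norm x" "norm x < 1" for x using r(2)[of x] that by simp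
  have r0: "0 < \<rho> \<tau>0" "\<rho> \<tau>0 < 1" using t0 rho_pos[of \<tau>0] rho_less_1[of \<tau>0] by auto
  have "compact (u ` cball 0 (\<rho> \<tau>0))"
    using r0 by (intro compact_continuous_image continuous_on_subset[OF sol_continuous(1)[OF u]]) auto
  then obtain M where M: "\<And>x. norm x \<le> \<rho> \<tau>0 \<Longrightarrow> u x \<le> M"
    using compact_imp_bounded bounded_real by (metis abs_le_iff image_eqI mem_cball_0)
  have b0: "b \<tau>0 > 0" using b_bounds t0 by simp
  define C where "C = max 0 ((M - a) / b \<tau>0)"
  have C: "0 \<le> C" "M - a \<le> C * b \<tau>0" using b0 by (auto simp: C_def field_simps max_def)
  show thesis
  proof (rule that[OF C(1) t0(1,2)])
    fix \<tau> and \<sigma> \<sigma>' :: 'a assume t: "\<tau>0 \<le> \<tau>" "\<tau> < 0" and \<sigma>: "norm \<sigma> = 1" "norm \<sigma>' = 1"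
    define \<phi> where "\<phi> = (\<lambda>\<delta>. (1 - \<delta>) * \<tau> + \<delta> / (2 * real N))"
    have lim: "(\<phi> \<longlongrightarrow> \<tau>) (at_right 0)" 
    proof -
      have "isCont \<phi> 0" unfolding \<phi>_def using N by (intro continuous_intros) auto
      then show ?thesis by (simp add: isCont_def filterlim_at_split \<phi>_def)
    qed
    have r: "0 < \<rho> \<tau>" "\<rho> \<tau> < 1" using t t0 rho_pos[of \<tau>] rho_less_1[of \<tau>] by auto
    have "isCont \<rho> \<tau>" using t t0 by (intro DERIV_isCont[OF rho_deriv]) auto
    moreover have "isCont v (\<rho> \<tau> *\<^sub>R \<sigma>')"
      using solD(1)[OF v, of "\<rho> \<tau> *\<^sub>R \<sigma>'"] \<sigma> r by (auto intro: has_derivative_continuous)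
    ultimately have "isCont (\<lambda>s. u (\<rho> \<tau> *\<^sub>R \<sigma>) - v (\<rho> s *\<^sub>R \<sigma>')) \<tau>"
      by (intro continuous_intros isCont_o2[of \<tau> "\<lambda>s. \<rho> s *\<^sub>R \<sigma>'" v]) auto
    from isCont_tendsto_compose[OF this lim]
    have "((\<lambda>\<delta>. u (\<rho> \<tau> *\<^sub>R \<sigma>) - v (\<rho> (\<phi> \<delta>) *\<^sub>R \<sigma>')) \<longlongrightarrow> u (\<rho> \<tau> *\<^sub>R \<sigma>) - v (\<rho> \<tau> *\<^sub>R \<sigma>')) (at_right 0)" .
    moreover have "eventually (\<lambda>\<delta>. \<phi> \<delta> < 0) (at_right 0)"
      using order_tendstoD(2)[OF lim t(2)] .
    moreover have "eventually (\<lambda>\<delta>::real. 0 < \<delta> \<and> \<delta> < 1) (at_right 0)"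
      by (simp add: eventually_at_right_field) (rule exI[of _ 1], simp)
    ultimately show "u (\<rho> \<tau> *\<^sub>R \<sigma>) - v (\<rho> \<tau> *\<^sub>R \<sigma>') \<le> C * b \<tau>"
    proof (elim tendsto_upperbound[OF _ _ trivial_limit_at_right_real])
      assume "\<forall>\<^sub>F \<delta> in at_right 0. \<phi> \<delta> < 0" "\<forall>\<^sub>F \<delta>::real in at_right 0. 0 < \<delta> \<and> \<delta> < 1"
      then show "\<forall>\<^sub>F \<delta> in at_right 0. u (\<rho> \<tau> *\<^sub>R \<sigma>) - v (\<rho> (\<phi> \<delta>) *\<^sub>R \<sigma>') \<le> C * b \<tau>"
      proof eventually_elim
        case (elim \<delta>)
        show ?case
          unfolding \<phi>_def
        proof (rule diff_shift_le[OF u v dim t0(1,2) va C(1) _ _ _ refl t(1) _ \<sigma>])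
          fix \<alpha> :: 'a assume "norm \<alpha> = 1"
          then show "u (\<rho> \<tau>0 *\<^sub>R \<alpha>) - a \<le> C * b \<tau>0" using M[of "\<rho> \<tau>0 *\<^sub>R \<alpha>"] r0 C by simp
        qed (use elim in \<open>auto simp: \<phi>_def\<close>)
      qed
    qed
  qed
qed

text \<open>The constant \<open>A\<close> is inherited from the single sphere \<tau> = T, whereas
  the constant of \<open>diff_le\<close> is not controlled by the data there. A difference that is
  small with a parameter on that sphere thus stays proportionally small up to the boundary, which is
  the form used for rotations. \<open>diff_le\<close> serves to show that the difference tends to 0
  from above at the boundary, and \<epsilon> leaves room for its cruder constant at the outer
  end.\<close>

lemma diff_propagate:
  fixes u v :: "'a::euclidean_space \<Rightarrow> real"
  assumes u: "blowup_solution f u G H" and v: "blowup_solution f v G' H'" and dim: "N = DIM('a)"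
    and A: "A > 0" "\<And>\<sigma>. norm \<sigma> = 1 \<Longrightarrow> u (\<rho> T *\<^sub>R \<sigma>) - v (\<rho> T *\<^sub>R \<sigma>) \<le> A * b T"
    and t: "T \<le> \<tau>" "\<tau> < 0" and \<sigma>: "norm \<sigma> = 1" and \<epsilon>: "0 < \<epsilon>" "\<epsilon> < 1"
  shows "u (\<rho> \<tau> *\<^sub>R \<sigma>) - v (\<rho> \<tau> *\<^sub>R \<sigma>) \<le> A * (b \<tau> + \<epsilon>)"
proof (rule ccontr)
  assume contra: "\<not> ?thesis"
  obtain C tc where C: "0 \<le> C" "T \<le> tc" "tc < 0"
    "\<And>\<tau> \<sigma> \<sigma>'. tc \<le> \<tau> \<Longrightarrow> \<tau> < 0 \<Longrightarrow> norm \<sigma> = 1 \<Longrightarrow> norm \<sigma>' = 1 \<Longrightarrow>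
      u (\<rho> \<tau> *\<^sub>R \<sigma>) - v (\<rho> \<tau> *\<^sub>R \<sigma>') \<le> C * b \<tau>"
    using diff_le[OF u v dim] by blast
  \<comment> \<open>The last entry makes the bound C b(te) from \<open>diff_le\<close> at most A
    \<epsilon>; \<open>C + 1\<close> keeps the denominator positive when C = 0.\<close>
  define te where "te = max \<tau> (max tc (- A * \<epsilon> / (C + 1)))"
  have te: "\<tau> \<le> te" "tc \<le> te" "te < 0" "- te \<le> A * \<epsilon> / (C + 1)"
    using t C A \<epsilon> by (auto simp: te_def)
  have end_le: "u (\<rho> te *\<^sub>R \<alpha>) - v (\<rho> te *\<^sub>R \<alpha>) \<le> A * \<epsilon>" if "norm \<alpha> = 1" for \<alpha>
  proof -
    have "C * b te \<le> (C + 1) * (- te)"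
      using C te t b_bounds[of te] by (intro mult_mono) auto
    also have "\<dots> \<le> A * \<epsilon>" using te C by (simp add: field_simps)
    finally show ?thesis using C(4)[OF te(2,3) that that] by simp
  qed
  have rng: "- 1/2 < s" "s < 0" if "T \<le> s" "s \<le> te" for s using that T te by auto
  have r1: "0 < \<rho> s" "\<rho> s < 1" if "T \<le> s" "s \<le> te" for s
    using rng[OF that] rho_pos[of s] rho_less_1[of s] by auto
  have b1: "b s > 0" "b s \<le> 1" if "T \<le> s" "s \<le> te" for s
    using b_bounds(3,4)[of s] rng(2)[OF that] that(1) by auto
  define Z where "Z = {T..te} \<times> sphere (0::'a) 1"
  define h where "h = (\<lambda>(s, \<sigma>). (u (\<rho> s *\<^sub>R \<sigma>) - v (\<rho> s *\<^sub>R \<sigma>)) / (b s + \<epsilon>))"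
  have Zx: "T \<le> fst x" "fst x \<le> te" "norm (snd x) = 1" if "x \<in> Z" for x
    using that by (auto simp: Z_def)
  have c1: "continuous_on Z (\<lambda>x. \<rho> (fst x))"
  proof (rule continuous_on_compose2[OF rho_continuous])
    show "fst ` Z \<subseteq> {- 1/2..0}"
    proof clarify
      fix x assume x: "x \<in> Z"
      show "fst x \<in> {- 1/2..0}" using rng[OF Zx(1,2)[OF x]] by simp
    qed
  qed (intro continuous_intros)
  have im1: "(\<lambda>x. \<rho> (fst x) *\<^sub>R snd x) ` Z \<subseteq> ball 0 1"
  proof clarify
    fix x assume x: "x \<in> Z"
    show "\<rho> (fst x) *\<^sub>R snd x \<in> ball 0 1" using r1[OF Zx(1,2)[OF x]] Zx(3)[OF x] by simp
  qed
  have "continuous_on Z h"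
    unfolding h_def split_beta
  proof (intro continuous_intros)
    show "continuous_on Z (\<lambda>x. u (\<rho> (fst x) *\<^sub>R snd x))"
      by (rule continuous_on_compose2[OF sol_continuous(1)[OF u] continuous_on_scaleR[OF c1] im1])
        (intro continuous_intros)
    show "continuous_on Z (\<lambda>x. v (\<rho> (fst x) *\<^sub>R snd x))"
      by (rule continuous_on_compose2[OF sol_continuous(1)[OF v] continuous_on_scaleR[OF c1] im1])
        (intro continuous_intros)
    show "continuous_on Z (\<lambda>x. b (fst x))"
      by (rule continuous_on_compose2[OF b_continuous[of UNIV]]) (auto intro: continuous_intros)
    show "\<forall>x\<in>Z. b (fst x) + \<epsilon> \<noteq> 0"
    proof
      fix x assume x: "x \<in> Z"
      show "b (fst x) + \<epsilon> \<noteq> 0" using b1(1)[OF Zx(1,2)[OF x]] \<epsilon> by simp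
    qed
  qed
  moreover have "compact Z" unfolding Z_def by (intro compact_Times compact_sphere compact_Icc)
  moreover have inZ: "(\<tau>, \<sigma>) \<in> Z" using t te \<sigma> by (simp add: Z_def)
  ultimately obtain z where z: "z \<in> Z" "\<And>y. y \<in> Z \<Longrightarrow> h y \<le> h z"
    using continuous_attains_sup[of Z h] by blast
  obtain t1 \<sigma>1 where z_eq: "z = (t1, \<sigma>1)" by (cases z)
  have t1: "T \<le> t1" "t1 \<le> te" and s1: "norm \<sigma>1 = 1" using z(1) by (auto simp: z_eq Z_def)
  define M where "M = h z"
  have Mle: "u (\<rho> s *\<^sub>R \<alpha>) - v (\<rho> s *\<^sub>R \<alpha>) \<le> M * (b s + \<epsilon>)"
    if "T \<le> s" "s \<le> te" "norm \<alpha> = 1" for s \<alpha>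
    using z(2)[of "(s, \<alpha>)"] that b1(1)[of s] \<epsilon> by (simp add: Z_def M_def h_def pos_divide_le_eq)
  have Meq: "u (\<rho> t1 *\<^sub>R \<sigma>1) - v (\<rho> t1 *\<^sub>R \<sigma>1) = M * (b t1 + \<epsilon>)"
    using b1(1)[OF t1] \<epsilon> by (simp add: M_def z_eq h_def)
  have "h (\<tau>, \<sigma>) > A"
    using contra b1(1)[of \<tau>] t te \<epsilon> by (simp add: h_def pos_less_divide_eq)
  then have MA: "M > A" using z(2)[OF inZ] by (simp add: M_def)
  then have M0: "M > 0" using A by simp
  have "t1 \<noteq> T"
  proof
    assume eq: "t1 = T"
    have "M * (b T + \<epsilon>) \<le> A * b T" using Meq A(2)[OF s1] unfolding eq by linarith
    also have "\<dots> \<le> A * (b T + \<epsilon>)" using A \<epsilon> by simp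
    finally show False using b1[of T] t te MA \<epsilon> by simp
  qed
  moreover have "t1 \<noteq> te"
  proof
    assume eq: "t1 = te"
    have "M * \<epsilon> < M * (b te + \<epsilon>)" using M0 b1(1)[OF t1] eq by simp
    also have "\<dots> \<le> A * \<epsilon>" using Meq end_le[OF s1] unfolding eq by linarith
    finally show False using MA \<epsilon> by simp
  qed
  ultimately have t1': "T < t1" "t1 < te" using t1 by auto
  note R = rng[OF t1] and R1 = r1[OF t1]
  let ?fu = "f (u (\<rho> t1 *\<^sub>R \<sigma>1))" and ?fv = "f (v (\<rho> t1 *\<^sub>R \<sigma>1))"
  have ff: "?fu - ?fv \<le> radlap G H (\<rho> t1) \<sigma>1 - radlap G' H' (\<rho> t1) \<sigma>1"
  proof (rule spherical_max_diff[OF u v R1 s1])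
    fix \<alpha> :: 'a assume "norm \<alpha> = 1"
    then show "u (\<rho> t1 *\<^sub>R \<alpha>) - v (\<rho> t1 *\<^sub>R \<alpha>) \<le> u (\<rho> t1 *\<^sub>R \<sigma>1) - v (\<rho> t1 *\<^sub>R \<sigma>1)"
      using Mle[OF t1, of \<alpha>] Meq by simp
  qed
  define p where "p = \<rho> t1 ^ (N - 1)"
  have "p\<^sup>2 * radlap G H (\<rho> t1) \<sigma>1 - p\<^sup>2 * radlap G' H' (\<rho> t1) \<sigma>1 - M * (- 2 * (K + 1)) \<le> 0"
  proof (rule second_derivative_at_max[where e = "min (t1 - T) (te - t1)" and x = t1 and
      g = "\<lambda>s. u (\<rho> s *\<^sub>R \<sigma>1) - v (\<rho> s *\<^sub>R \<sigma>1) - M * b s" and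
      g' = "\<lambda>s. (G (\<rho> s *\<^sub>R \<sigma>1) \<bullet> \<sigma>1) * \<rho> s ^ (N - 1)
         - (G' (\<rho> s *\<^sub>R \<sigma>1) \<bullet> \<sigma>1) * \<rho> s ^ (N - 1) - M * (- 1 - 2 * (K + 1) * s)"])
    fix s assume "\<bar>s - t1\<bar> < min (t1 - T) (te - t1)"
    then have s: "T \<le> s" "s \<le> te" by auto
    note S = rng[OF s]
    show "((\<lambda>s. u (\<rho> s *\<^sub>R \<sigma>1) - v (\<rho> s *\<^sub>R \<sigma>1) - M * b s) has_real_derivative
         (G (\<rho> s *\<^sub>R \<sigma>1) \<bullet> \<sigma>1) * \<rho> s ^ (N - 1)
         - (G' (\<rho> s *\<^sub>R \<sigma>1) \<bullet> \<sigma>1) * \<rho> s ^ (N - 1) - M * (- 1 - 2 * (K + 1) * s)) (at s)"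
      by (intro DERIV_diff DERIV_cmult b_deriv sol_radial(1)[OF u S s1 dim] sol_radial(1)[OF v S s1 dim])
    show "u (\<rho> s *\<^sub>R \<sigma>1) - v (\<rho> s *\<^sub>R \<sigma>1) - M * b s
       \<le> u (\<rho> t1 *\<^sub>R \<sigma>1) - v (\<rho> t1 *\<^sub>R \<sigma>1) - M * b t1"
      using Mle[OF s s1] Meq by (simp add: algebra_simps)
  next
    have "((\<lambda>s. M * (- 1 - 2 * (K + 1) * s)) has_real_derivative M * (- 2 * (K + 1))) (at t1)"
      by (auto intro!: derivative_eq_intros)
    then show "((\<lambda>s. (G (\<rho> s *\<^sub>R \<sigma>1) \<bullet> \<sigma>1) * \<rho> s ^ (N - 1)
         - (G' (\<rho> s *\<^sub>R \<sigma>1) \<bullet> \<sigma>1) * \<rho> s ^ (N - 1) - M * (- 1 - 2 * (K + 1) * s)) has_real_derivative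
       p\<^sup>2 * radlap G H (\<rho> t1) \<sigma>1 - p\<^sup>2 * radlap G' H' (\<rho> t1) \<sigma>1 - M * (- 2 * (K + 1))) (at t1)"
      unfolding p_def
      by (intro DERIV_diff sol_radial(2)[OF u R s1 dim] sol_radial(2)[OF v R s1 dim])
  qed (use t1' in auto)
  then have dd: "p\<^sup>2 * (radlap G H (\<rho> t1) \<sigma>1 - radlap G' H' (\<rho> t1) \<sigma>1) + 2 * (K + 1) * M \<le> 0"
    by (simp add: algebra_simps)
  have p: "0 < p" "p \<le> 1" using R1 by (auto simp: p_def intro!: power_le_one)
  \<comment> \<open>Here b + \<epsilon> can exceed 1. The factor 2 in b'' = - 2 (K + 1) makes up for
    it: 2 (K + 1) M still exceeds K (2 M).\<close>
  have "b t1 + \<epsilon> \<le> 2" "0 < b t1 + \<epsilon>" using b1[OF t1] \<epsilon> by auto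
  then have Mb: "0 \<le> M * (b t1 + \<epsilon>)" "M * (b t1 + \<epsilon>) \<le> M * 2"
    using M0 by (auto intro: mult_left_mono simp del: mult.commute)
  have "- K * (M * (b t1 + \<epsilon>)) \<le> ?fu - ?fv"
    using one_sided_lipschitz[of "v (\<rho> t1 *\<^sub>R \<sigma>1)" "u (\<rho> t1 *\<^sub>R \<sigma>1)"] Meq Mb by simp
  with ff have "- K * (M * (b t1 + \<epsilon>)) \<le> radlap G H (\<rho> t1) \<sigma>1 - radlap G' H' (\<rho> t1) \<sigma>1" by linarith
  then have "p\<^sup>2 * (- K * (M * (b t1 + \<epsilon>))) \<le> p\<^sup>2 * (radlap G H (\<rho> t1) \<sigma>1 - radlap G' H' (\<rho> t1) \<sigma>1)"
    by (intro mult_left_mono) auto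
  moreover have "p\<^sup>2 * (K * (M * (b t1 + \<epsilon>))) \<le> 1 * (K * (M * 2))"
    using p K Mb by (intro mult_mono[OF power_le_one mult_left_mono]) auto
  ultimately have "- (K * (M * 2)) + 2 * (K + 1) * M \<le> 0" using dd by simp
  then show False using M0 by (simp add: algebra_simps)
qed

text \<open>On the sphere of radius \<rho> T the solution is Lipschitz, so it differs from its
  rotation by the angle 2 s by O(s). \<open>diff_propagate\<close> carries this linear bound to
  every larger sphere inside the ball with the same constant, and differentiation at s = 0 gives the
  claim.\<close>

lemma tangential_gradient_bound:
  fixes u :: "'a::euclidean_space \<Rightarrow> real"
  assumes u: "blowup_solution f u G H" and dim: "N = DIM('a)"
  obtains B where "0 \<le> B" "\<And>\<tau> \<sigma> \<omega>. T \<le> \<tau> \<Longrightarrow> \<tau> < 0 \<Longrightarrow> norm \<sigma> = 1 \<Longrightarrow> norm \<omega> = 1 \<Longrightarrow> \<sigma> \<bullet> \<omega> = 0 \<Longrightarrow>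
      G (\<rho> \<tau> *\<^sub>R \<sigma>) \<bullet> \<omega> \<le> B"
proof -
  have T4: "- 1/4 \<le> T" "T < 0" using T by auto
  have rT: "0 < \<rho> T" "\<rho> T < 1" using T4 rho_pos[of T] rho_less_1[of T] by auto
  have bT: "0 < b T" using b_bounds T by auto
  have "compact (G ` cball 0 (\<rho> T))"
    using rT by (intro compact_continuous_image continuous_on_subset[OF sol_continuous(2)[OF u]]) auto
  then obtain L where L: "0 < L" "\<And>x. norm x \<le> \<rho> T \<Longrightarrow> norm (G x) \<le> L"
    using compact_imp_bounded bounded_pos by (metis image_eqI mem_cball_0)
  have Lip: "norm (u x - u y) \<le> L * norm (x - y)" if "norm x \<le> \<rho> T" "norm y \<le> \<rho> T" for x y
  proof (rule differentiable_bound[where S = "cball 0 (\<rho> T)" and f' = "\<lambda>x h. G x \<bullet> h"])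
    fix x :: 'a assume x: "x \<in> cball 0 (\<rho> T)"
    then show "(u has_derivative (\<bullet>) (G x)) (at x within cball 0 (\<rho> T))"
      using solD(1)[OF u, of x] rT by (auto intro: has_derivative_at_withinI)
    show "onorm ((\<bullet>) (G x)) \<le> L"
    proof (rule onorm_le)
      fix y
      have "\<bar>G x \<bullet> y\<bar> \<le> norm (G x) * norm y" by (rule Cauchy_Schwarz_ineq2)
      also have "\<dots> \<le> L * norm y" using L(2)[of x] x by (intro mult_right_mono) auto
      finally show "norm (G x \<bullet> y) \<le> L * norm y" by simp
    qed
  qed (use that in auto)
  \<comment> \<open>The 8 is the 4 of \<open>hrefl_diff\<close> times the 2 of \<open>mdist\<close>;
    dividing by \<open>b T\<close> puts the bound on the initial sphere in the form B s b(T) that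
    \<open>diff_propagate\<close> asks for.\<close>
  define B where "B = 8 * L / b T"
  have B0: "B > 0" using L bT by (simp add: B_def)
  show thesis
  proof (rule that[of "B / (2 * \<rho> T)"])
    show "0 \<le> B / (2 * \<rho> T)" using B0 rT by simp
    fix \<tau> and \<sigma> \<omega> :: 'a
    assume t: "T \<le> \<tau>" "\<tau> < 0" and \<sigma>: "norm \<sigma> = 1" and \<omega>: "norm \<omega> = 1" and orth: "\<sigma> \<bullet> \<omega> = 0"
    have r: "\<rho> T \<le> \<rho> \<tau>" "\<rho> \<tau> < 1" using t T4 rho_mono[of T \<tau>] rho_less_1[of \<tau>] by auto
    define m where "m = (\<lambda>s. cos s *\<^sub>R \<sigma> + sin s *\<^sub>R \<omega>)"
    have in1: "\<sigma> \<bullet> \<sigma> = 1" "\<omega> \<bullet> \<omega> = 1" "\<omega> \<bullet> \<sigma> = 0" using \<sigma> \<omega> orth by (auto simp: norm_eq_1 inner_commute)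
    have nm: "norm (m s) = 1" for s
      using sin_cos_squared_add[of s] in1 orth
      by (simp add: norm_eq_1 m_def inner_add_left inner_add_right power2_eq_square)
    have mdist: "norm (m s - \<sigma>) \<le> 2 * s" if "0 < s" for s
    proof -
      have "cos s - 1 = - 2 * (sin (s / 2))\<^sup>2" using cos_double_sin[of "s / 2"] by simp
      then have "\<bar>cos s - 1\<bar> = 2 * (\<bar>sin (s / 2)\<bar> * \<bar>sin (s / 2)\<bar>)" by (simp add: power2_eq_square abs_mult)
      also have "\<dots> \<le> 2 * (1 * \<bar>s / 2\<bar>)"
        by (intro mult_left_mono mult_mono abs_sin_le_one abs_sin_x_le_abs_x) auto
      finally have "\<bar>cos s - 1\<bar> \<le> s" using that by simp
      moreover have "\<bar>sin s\<bar> \<le> s" using abs_sin_x_le_abs_x[of s] that by simp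
      moreover have "m s - \<sigma> = (cos s - 1) *\<^sub>R \<sigma> + sin s *\<^sub>R \<omega>" by (simp add: m_def algebra_simps)
      then have "norm (m s - \<sigma>) \<le> \<bar>cos s - 1\<bar> + \<bar>sin s\<bar>"
        using norm_triangle_ineq[of "(cos s - 1) *\<^sub>R \<sigma>" "sin s *\<^sub>R \<omega>"] \<sigma> \<omega> by simp
      ultimately show ?thesis by linarith
    qed
    have step: "u (\<rho> \<tau> *\<^sub>R m (2 * s)) \<le> u (\<rho> \<tau> *\<^sub>R \<sigma>) + B * s" if s: "0 < s" for s
    proof -
      define R where "R = (\<lambda>x. hrefl (m s) (hrefl \<sigma> x))"
      have R: "orthogonal_transformation R"
        using orthogonal_transformation_compose[OF hrefl_orthogonal[OF nm] hrefl_orthogonal[OF \<sigma>], of s]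
        by (simp add: R_def o_def)
      have Rs: "R (c *\<^sub>R \<sigma>) = c *\<^sub>R m (2 * s)" for c
      proof -
        have "R (c *\<^sub>R \<sigma>) = (c * (2 * (cos s)\<^sup>2 - 1)) *\<^sub>R \<sigma> + (c * (2 * sin s * cos s)) *\<^sub>R \<omega>"
          using in1 orth
          by (simp add: R_def hrefl_def m_def inner_add_right algebra_simps power2_eq_square)
            (simp flip: scaleR_add_left)
        also have "2 * (cos s)\<^sup>2 - 1 = cos (2 * s)" by (simp add: cos_double_cos)
        also have "2 * sin s * cos s = sin (2 * s)" by (simp add: sin_double)
        finally show ?thesis by (simp add: m_def scaleR_add_right)
      qed
      have 1: "u (R (\<rho> T *\<^sub>R \<alpha>)) - u (\<rho> T *\<^sub>R \<alpha>) \<le> B * s * b T" if \<alpha>: "norm \<alpha> = 1" for \<alpha>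
      proof -
        have nn: "norm (R (\<rho> T *\<^sub>R \<alpha>)) = \<rho> T" "norm (\<rho> T *\<^sub>R \<alpha>) = \<rho> T"
          using R rT \<alpha> by (auto simp: orthogonal_transformation)
        have "norm (R (\<rho> T *\<^sub>R \<alpha>) - \<rho> T *\<^sub>R \<alpha>) \<le> 4 * norm (m s - \<sigma>) * norm (\<rho> T *\<^sub>R \<alpha>)"
          unfolding R_def by (rule hrefl_diff[OF nm \<sigma>])
        also have "\<dots> \<le> 4 * (2 * s) * 1"
          using mdist[OF s] nn rT s by (intro mult_mono) auto
        finally have "L * norm (R (\<rho> T *\<^sub>R \<alpha>) - \<rho> T *\<^sub>R \<alpha>) \<le> L * (4 * (2 * s) * 1)"
          using L by (intro mult_left_mono) auto
        moreover have "norm (u (R (\<rho> T *\<^sub>R \<alpha>)) - u (\<rho> T *\<^sub>R \<alpha>)) \<le> L * norm (R (\<rho> T *\<^sub>R \<alpha>) - \<rho> T *\<^sub>R \<alpha>)"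
          using nn by (intro Lip) auto
        ultimately show ?thesis using bT by (simp add: B_def algebra_simps)
      qed
      have "u (R (\<rho> \<tau> *\<^sub>R \<sigma>)) - u (\<rho> \<tau> *\<^sub>R \<sigma>) \<le> B * s * b \<tau>"
      proof (rule field_le_epsilon)
        fix e :: real assume e: "e > 0"
        define \<epsilon> where "\<epsilon> = min (1/2) (e / (B * s))"
        have eps: "0 < \<epsilon>" "\<epsilon> < 1" "B * s * \<epsilon> \<le> e" using e B0 s by (auto simp: \<epsilon>_def min_def field_simps)
        have "u (R (\<rho> \<tau> *\<^sub>R \<sigma>)) - u (\<rho> \<tau> *\<^sub>R \<sigma>) \<le> B * s * (b \<tau> + \<epsilon>)"
          using B0 s by (intro diff_propagate[OF sol_rotate[OF u R] u dim _ 1 t \<sigma> eps(1,2)]) auto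
        then show "u (R (\<rho> \<tau> *\<^sub>R \<sigma>)) - u (\<rho> \<tau> *\<^sub>R \<sigma>) \<le> B * s * b \<tau> + e"
          using eps(3) by (simp add: algebra_simps)
      qed
      also have "\<dots> \<le> B * s * 1" using B0 s b_bounds(4)[OF t] by (intro mult_left_mono) auto
      finally show ?thesis by (simp add: Rs)
    qed
    have dm: "((\<lambda>s. \<rho> \<tau> *\<^sub>R m (2 * s)) has_vector_derivative (2 * \<rho> \<tau>) *\<^sub>R \<omega>) (at 0)"
      unfolding m_def has_vector_derivative_def by (auto intro!: derivative_eq_intros)
    have "((\<lambda>s. u (\<rho> \<tau> *\<^sub>R m (2 * s))) has_real_derivative G (\<rho> \<tau> *\<^sub>R m (2 * 0)) \<bullet> ((2 * \<rho> \<tau>) *\<^sub>R \<omega>)) (at 0)"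
      by (rule sol_curve(1)[OF u _ dm]) (use nm r rT in simp)
    then have "G (\<rho> \<tau> *\<^sub>R m (2 * 0)) \<bullet> ((2 * \<rho> \<tau>) *\<^sub>R \<omega>) \<le> B"
      by (rule derivative_le[where d = 1]) (use step in \<open>auto simp: m_def\<close>)
    then have "2 * \<rho> \<tau> * (G (\<rho> \<tau> *\<^sub>R \<sigma>) \<bullet> \<omega>) \<le> B" by (simp add: m_def)
    then have "G (\<rho> \<tau> *\<^sub>R \<sigma>) \<bullet> \<omega> \<le> B / (2 * \<rho> \<tau>)" using r rT by (simp add: field_simps)
    also have "\<dots> \<le> B / (2 * \<rho> T)" using r rT B0 by (intro divide_left_mono) auto
    finally show "G (\<rho> \<tau> *\<^sub>R \<sigma>) \<bullet> \<omega> \<le> B / (2 * \<rho> T)" .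
  qed
qed

end

section \<open>Reflection in a sphere\<close>

lemma finite_compact_attains_sup:
  fixes F :: "'c \<Rightarrow> 'z::topological_space \<Rightarrow> real"
  assumes "finite I" "I \<noteq> {}" "compact Z" "Z \<noteq> {}" "\<And>c. c \<in> I \<Longrightarrow> continuous_on Z (F c)"
  obtains c z where "c \<in> I" "z \<in> Z" "\<And>c' z'. c' \<in> I \<Longrightarrow> z' \<in> Z \<Longrightarrow> F c' z' \<le> F c z"
proof -
  have "\<exists>z\<in>Z. \<forall>z'\<in>Z. F c z' \<le> F c z" if "c \<in> I" for c
    using continuous_attains_sup[OF assms(3,4) assms(5)[OF that]] .
  then obtain m where m: "\<And>c. c \<in> I \<Longrightarrow> m c \<in> Z" "\<And>c z'. c \<in> I \<Longrightarrow> z' \<in> Z \<Longrightarrow> F c z' \<le> F c (m c)"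
    by metis
  define X where "X = (\<lambda>c. F c (m c)) ` I"
  have X: "finite X" "X \<noteq> {}" using assms by (auto simp: X_def)
  obtain c where c: "c \<in> I" "Max X = F c (m c)" using Max_in[OF X] by (auto simp: X_def)
  show thesis
  proof (rule that[OF c(1) m(1)[OF c(1)]])
    fix c' z' assume "c' \<in> I" "z' \<in> Z"
    then have "F c' z' \<le> F c' (m c')" "F c' (m c') \<in> X" using m by (auto simp: X_def)
    then show "F c' z' \<le> F c (m c)" using Max_ge[OF X(1)] c by fastforce
  qed
qed

text \<open>The interval [t0, t0/2] is reflected onto [3/2 t0, t0], which explains the lower limit
  for \<open>r\<close> in \<open>diff\<close>. The parameter \<open>t0\<close> ranges over all
  spheres near the boundary while \<open>K\<close> and \<open>C\<close> stay fixed, so the final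
  bound must be free of \<open>t0\<close>. Indexing by \<open>bool\<close> lets extrema be taken
  over both solutions at once.\<close>

locale reflection =
  fixes f :: "real \<Rightarrow> real" and K C t0 :: real
    and u :: "bool \<Rightarrow> 'a::euclidean_space \<Rightarrow> real" and G H
  assumes K: "0 \<le> K" and one_sided_lipschitz: "\<And>s t. t \<le> s \<Longrightarrow> - K * (s - t) \<le> f s - f t"
    and sol: "\<And>i. blowup_solution f (u i) (G i) (H i)"
    and C: "0 \<le> C"
    and t0: "- 1/2 \<le> t0" "t0 < 0"
    and diff: "\<And>i j r \<alpha> \<beta>. exp (3/2 * t0) \<le> r \<Longrightarrow> r < 1 \<Longrightarrow> norm \<alpha> = 1 \<Longrightarrow> norm \<beta> = 1 \<Longrightarrow>
      u i (r *\<^sub>R \<alpha>) - u j (r *\<^sub>R \<beta>) \<le> C * (1 - r)"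
begin

text \<open>In t = log r, the quantity r^2 \<open>radlap\<close> becomes u'' + 2 \<kappa> u'.
  Multiplying u by exp(\<kappa> t) trades the first-order term for a multiple of u, and an operator
  without first-order term is compatible with t \<mapsto> 2 t0 - t.\<close>

definition \<kappa> :: real where "\<kappa> = (real DIM('a) - 2) / 2"

definition W :: real where "W = exp \<bar>\<kappa>\<bar>"

text \<open>With \<open>t = log |x|\<close> and the weight \<open>exp (\<kappa> t)\<close>, the Kelvin transform in the sphere of radius \<open>exp t0\<close> is \<open>t \<mapsto> 2 t0 - t\<close>.\<close>

definition Y :: "bool \<Rightarrow> real \<Rightarrow> 'a \<Rightarrow> real" where
  "Y i t \<sigma> = exp (\<kappa> * t) * u i (exp t *\<^sub>R \<sigma>)"

definition Y1 :: "bool \<Rightarrow> real \<Rightarrow> 'a \<Rightarrow> real" where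
  "Y1 i t \<sigma> = exp (\<kappa> * t) * (\<kappa> * u i (exp t *\<^sub>R \<sigma>) + exp t * (G i (exp t *\<^sub>R \<sigma>) \<bullet> \<sigma>))"

definition Y2 :: "bool \<Rightarrow> real \<Rightarrow> 'a \<Rightarrow> real" where
  "Y2 i t \<sigma> = exp (\<kappa> * t) * (\<kappa>\<^sup>2 * u i (exp t *\<^sub>R \<sigma>) + (exp t)\<^sup>2 * radlap (G i) (H i) (exp t) \<sigma>)"

lemma Y_deriv:
  assumes t: "t < 0" and \<sigma>: "norm \<sigma> = 1"
  shows "((\<lambda>t. Y i t \<sigma>) has_real_derivative Y1 i t \<sigma>) (at t)"
    and "((\<lambda>t. Y1 i t \<sigma>) has_real_derivative Y2 i t \<sigma>) (at t)"
proof -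
  have n: "norm (exp t *\<^sub>R \<sigma>) < 1" using t \<sigma> by simp
  have d: "((\<lambda>t. exp t *\<^sub>R \<sigma>) has_vector_derivative exp t *\<^sub>R \<sigma>) (at t)"
    by (auto intro!: derivative_eq_intros)
  have 1: "((\<lambda>t. u i (exp t *\<^sub>R \<sigma>)) has_real_derivative exp t * (G i (exp t *\<^sub>R \<sigma>) \<bullet> \<sigma>)) (at t)"
    using sol_curve(1)[OF sol[of i] n d] by simp
  have "((\<lambda>t. G i (exp t *\<^sub>R \<sigma>) \<bullet> \<sigma>) has_real_derivative
      H i (exp t *\<^sub>R \<sigma>) (exp t *\<^sub>R \<sigma>) \<bullet> \<sigma> + G i (exp t *\<^sub>R \<sigma>) \<bullet> 0) (at t)"
    by (rule sol_curve(2)[OF sol n d]) simp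
  then have 2: "((\<lambda>t. G i (exp t *\<^sub>R \<sigma>) \<bullet> \<sigma>) has_real_derivative exp t * (H i (exp t *\<^sub>R \<sigma>) \<sigma> \<bullet> \<sigma>)) (at t)"
    using solD(4)[OF sol[of i] n] by (simp add: linear_scale)
  show "((\<lambda>t. Y i t \<sigma>) has_real_derivative Y1 i t \<sigma>) (at t)"
    unfolding Y_def Y1_def by (auto intro!: derivative_eq_intros 1 simp: algebra_simps)
  show "((\<lambda>t. Y1 i t \<sigma>) has_real_derivative Y2 i t \<sigma>) (at t)"
    unfolding Y1_def Y2_def radlap_def
    by (auto intro!: derivative_eq_intros 1 2 simp: \<kappa>_def field_simps power2_eq_square)
qed

lemma Y_reflected_deriv:
  assumes t: "2 * t0 - t < 0" and \<sigma>: "norm \<sigma> = 1"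
  shows "((\<lambda>t. Y i (2 * t0 - t) \<sigma>) has_real_derivative - Y1 i (2 * t0 - t) \<sigma>) (at t)"
    and "((\<lambda>t. - Y1 i (2 * t0 - t) \<sigma>) has_real_derivative Y2 i (2 * t0 - t) \<sigma>) (at t)"
proof -
  have d: "((\<lambda>t. 2 * t0 - t) has_real_derivative - 1) (at t)" by (auto intro!: derivative_eq_intros)
  show "((\<lambda>t. Y i (2 * t0 - t) \<sigma>) has_real_derivative - Y1 i (2 * t0 - t) \<sigma>) (at t)"
    using DERIV_chain2[OF Y_deriv(1)[OF t \<sigma>] d] by simp
  show "((\<lambda>t. - Y1 i (2 * t0 - t) \<sigma>) has_real_derivative Y2 i (2 * t0 - t) \<sigma>) (at t)"
    using DERIV_minus[OF DERIV_chain2[OF Y_deriv(2)[OF t \<sigma>] d]] by simp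
qed

lemma Y_continuous:
  assumes "continuous_on Z g" "continuous_on Z s" "\<And>z. z \<in> Z \<Longrightarrow> g z < 0" "\<And>z. z \<in> Z \<Longrightarrow> norm (s z) = 1"
  shows "continuous_on Z (\<lambda>z. Y i (g z) (s z))"
  unfolding Y_def
proof (intro continuous_intros assms(1))
  show "continuous_on Z (\<lambda>z. u i (exp (g z) *\<^sub>R s z))"
  proof (rule continuous_on_compose2[OF sol_continuous(1)[OF sol]])
    show "(\<lambda>z. exp (g z) *\<^sub>R s z) ` Z \<subseteq> ball 0 1" using assms(3,4) by auto
  qed (intro continuous_intros assms)
qed

lemma u_diff:
  assumes "3/2 * t0 \<le> t" "t < 0" "norm \<alpha> = 1" "norm \<beta> = 1"
  shows "u i (exp t *\<^sub>R \<alpha>) - u j (exp t *\<^sub>R \<beta>) \<le> - (C * t)"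
    and "u i (exp t *\<^sub>R \<alpha>) - u j (exp t *\<^sub>R \<beta>) \<le> C"
proof -
  have "u i (exp t *\<^sub>R \<alpha>) - u j (exp t *\<^sub>R \<beta>) \<le> C * (1 - exp t)"
    using assms by (intro diff) auto
  moreover have "1 - exp t \<le> - t" using exp_ge_add_one_self[of t] by linarith
  then have "C * (1 - exp t) \<le> C * - t" using C by (rule mult_left_mono)
  moreover have "C * (1 - exp t) \<le> C * 1" using C by (intro mult_left_mono) auto
  ultimately show "u i (exp t *\<^sub>R \<alpha>) - u j (exp t *\<^sub>R \<beta>) \<le> - (C * t)"
    "u i (exp t *\<^sub>R \<alpha>) - u j (exp t *\<^sub>R \<beta>) \<le> C" by linarith+
qed

lemma exp_kappa_le:
  assumes "- 1 \<le> t" "t \<le> 0"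
  shows "exp (\<kappa> * t) \<le> W" "exp (- (\<kappa> * t)) \<le> W"
proof -
  have "\<bar>\<kappa> * t\<bar> \<le> \<bar>\<kappa>\<bar> * 1" unfolding abs_mult using assms by (intro mult_left_mono) auto
  then show "exp (\<kappa> * t) \<le> W" "exp (- (\<kappa> * t)) \<le> W" by (auto simp: W_def)
qed

lemma W: "W \<ge> 1" by (simp add: W_def)

lemma Y_diff:
  assumes "3/2 * t0 \<le> t" "t < 0" "norm \<alpha> = 1" "norm \<beta> = 1"
  shows "Y i t \<alpha> - Y j t \<beta> \<le> W * (- (C * t))"
proof -
  have "Y i t \<alpha> - Y j t \<beta> = exp (\<kappa> * t) * (u i (exp t *\<^sub>R \<alpha>) - u j (exp t *\<^sub>R \<beta>))"
    by (simp add: Y_def algebra_simps)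
  also have "\<dots> \<le> exp (\<kappa> * t) * (- (C * t))" using u_diff(1)[OF assms] by (intro mult_left_mono) auto
  also have "\<dots> \<le> W * (- (C * t))"
    using assms t0 C by (intro mult_right_mono exp_kappa_le) (auto simp: mult_le_0_iff)
  finally show ?thesis .
qed

text \<open>At an interior maximum the terms with \<open>f\<close> cost at most 4 W K C: two radii,
  two ordered pairs at each, weight at most W. The quadratic part of the barrier contributes 2 L,
  which must be strictly larger.\<close>

definition L :: real where "L = 4 * W * K * C + 1"

text \<open>At the outer end t - t0 = - t0 / 2, so 16 W C contributes 8 W C (- t0), enough for the 6
  W C (- t0) that bounds \<open>e\<close> there; the additional L pays for L (t - t0)^2. Both sides
  scale with - t0, hence A does not involve it.\<close>

definition A :: real where "A = 16 * W * C + L"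

text \<open>\<open>M\<close> and \<open>m\<close> enter through free points \<open>\<alpha>, \<beta>, \<gamma>, \<eta>\<close> of the sphere and free choices of the solution, so that \<open>e\<close> is smooth in \<open>t\<close>.\<close>

definition e :: "bool \<times> bool \<times> bool \<times> bool \<Rightarrow> real \<times> 'a \<times> 'a \<times> 'a \<times> 'a \<times> 'a \<Rightarrow> real" where
  "e = (\<lambda>(i, j, k, l) (t, \<sigma>, \<alpha>, \<beta>, \<gamma>, \<eta>).
     Y i t \<alpha> - Y j t \<beta> + (Y True t \<sigma> - Y False t \<sigma>) +
     (Y k (2 * t0 - t) \<gamma> - Y l (2 * t0 - t) \<eta> - (Y True (2 * t0 - t) \<sigma> - Y False (2 * t0 - t) \<sigma>)))"

lemma L: "L \<ge> 1" using W K C by (simp add: L_def)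

text \<open>A maximum principle for \<open>e\<close> minus the barrier, over t, all sphere points
  and all choices of solutions. At an interior maximum the extremal values bracket those of both
  solutions at \<sigma>, which gives the \<kappa>^2 terms a sign and orders the arguments of
  \<open>f\<close>. The spherical Laplacians of w at the two radii have no sign separately; only
  their weighted combination is controlled, by maximality in the common point \<sigma>.\<close>

lemma e_barrier:
  assumes \<Phi>: "0 \<le> \<Phi>" "\<And>i j \<alpha> \<beta>. norm \<alpha> = 1 \<Longrightarrow> norm \<beta> = 1 \<Longrightarrow> Y i t0 \<alpha> - Y j t0 \<beta> \<le> \<Phi>"
    and t: "t0 \<le> t" "t \<le> t0 / 2"
    and n: "norm \<sigma> = 1" "norm \<alpha> = 1" "norm \<beta> = 1" "norm \<gamma> = 1" "norm \<eta> = 1"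
  shows "e c (t, \<sigma>, \<alpha>, \<beta>, \<gamma>, \<eta>) \<le> 2 * \<Phi> + A * (t - t0) - L * (t - t0)\<^sup>2"
proof (rule ccontr)
  assume contra: "\<not> ?thesis"
  define Z where "Z = {t0..t0/2} \<times> sphere (0::'a) 1 \<times> sphere (0::'a) 1 \<times> sphere (0::'a) 1 \<times> sphere (0::'a) 1 \<times> sphere (0::'a) 1"
  define B where "B = (\<lambda>t. 2 * \<Phi> + A * (t - t0) - L * (t - t0)\<^sup>2)"
  define F where "F = (\<lambda>c z. e c z - B (fst z))"
  have "compact Z" unfolding Z_def by (intro compact_Times compact_sphere compact_Icc)
  have inZ: "(t, \<sigma>, \<alpha>, \<beta>, \<gamma>, \<eta>) \<in> Z" using t n by (simp add: Z_def)
  have cont: "continuous_on Z (F c)" for c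
  proof -
    obtain i j k l where c: "c = (i, j, k, l)" by (cases c) auto
    have Zx: "fst x < 0" "2 * t0 - fst x < 0" "norm (fst (snd x)) = 1" "norm (fst (snd (snd x))) = 1"
      "norm (fst (snd (snd (snd x)))) = 1" "norm (fst (snd (snd (snd (snd x))))) = 1"
      "norm (snd (snd (snd (snd (snd x))))) = 1" if "x \<in> Z" for x
      using that t0 by (auto simp: Z_def)
    show ?thesis
      unfolding F_def e_def c B_def split_beta fst_conv snd_conv
      by (intro continuous_intros Y_continuous Zx)
  qed
  have ne: "Z \<noteq> {}" using inZ by blast
  obtain c1 z1 where z1: "z1 \<in> Z" "\<And>c' z'. z' \<in> Z \<Longrightarrow> F c' z' \<le> F c1 z1"
    using finite_compact_attains_sup[where F = F, OF finite[of UNIV] UNIV_not_empty \<open>compact Z\<close> ne cont] by (metis UNIV_I)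
  obtain i j k l where c1: "c1 = (i, j, k, l)" by (cases c1) auto
  obtain s \<sigma> \<alpha> \<beta> \<gamma> \<eta> where z1_eq: "z1 = (s, \<sigma>, \<alpha>, \<beta>, \<gamma>, \<eta>)" by (cases z1) auto
  have s: "t0 \<le> s" "s \<le> t0 / 2" and n1: "norm \<sigma> = 1" "norm \<alpha> = 1" "norm \<beta> = 1" "norm \<gamma> = 1" "norm \<eta> = 1"
    using z1(1) by (auto simp: Z_def z1_eq)
  define s' where "s' = 2 * t0 - s"
  have rng: "3/2 * t0 \<le> s" "s < 0" "3/2 * t0 \<le> s'" "s' < 0" "- 1 \<le> s" "- 1 \<le> s'" "s' \<le> t0"
    using s t0 by (auto simp: s'_def)
  have max: "e (i', j', k', l') (x, \<sigma>', \<alpha>', \<beta>', \<gamma>', \<eta>') - B x \<le> e (i, j, k, l) (s, \<sigma>, \<alpha>, \<beta>, \<gamma>, \<eta>) - B s"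
    if "t0 \<le> x" "x \<le> t0/2" "norm \<sigma>' = 1" "norm \<alpha>' = 1" "norm \<beta>' = 1" "norm \<gamma>' = 1" "norm \<eta>' = 1"
    for i' j' k' l' x \<sigma>' \<alpha>' \<beta>' \<gamma>' \<eta>'
    using z1(2)[of "(x, \<sigma>', \<alpha>', \<beta>', \<gamma>', \<eta>')" "(i', j', k', l')"] that
    by (simp add: Z_def F_def c1 z1_eq)
  have "F c (t, \<sigma>', \<alpha>', \<beta>', \<gamma>', \<eta>') \<le> F c1 z1" if "(t, \<sigma>', \<alpha>', \<beta>', \<gamma>', \<eta>') \<in> Z" for \<sigma>' \<alpha>' \<beta>' \<gamma>' \<eta>'
    using z1(2) that by blast
  from this[OF inZ] have pos: "e (i, j, k, l) (s, \<sigma>, \<alpha>, \<beta>, \<gamma>, \<eta>) > B s"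
    using contra by (simp add: F_def c1 z1_eq B_def)
  have Y\<alpha>: "Y i' s \<alpha>' \<le> Y i s \<alpha>" if "norm \<alpha>' = 1" for i' \<alpha>'
    using max[OF s n1(1) that n1(3-5), of i' j k l] by (simp add: e_def)
  have Y\<beta>: "Y j s \<beta> \<le> Y j' s \<beta>'" if "norm \<beta>' = 1" for j' \<beta>'
    using max[OF s n1(1-2) that n1(4-5), of i j' k l] by (simp add: e_def)
  have Y\<gamma>: "Y k' s' \<gamma>' \<le> Y k s' \<gamma>" if "norm \<gamma>' = 1" for k' \<gamma>'
    using max[OF s n1(1-3) that n1(5), of i j k' l] by (simp add: e_def s'_def)
  have Y\<eta>: "Y l s' \<eta> \<le> Y l' s' \<eta>'" if "norm \<eta>' = 1" for l' \<eta>'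
    using max[OF s n1(1-4) that, of i j k l'] by (simp add: e_def s'_def)
  have Y\<sigma>: "Y True s \<sigma>' - Y False s \<sigma>' - (Y True s' \<sigma>' - Y False s' \<sigma>')
      \<le> Y True s \<sigma> - Y False s \<sigma> - (Y True s' \<sigma> - Y False s' \<sigma>)" if "norm \<sigma>' = 1" for \<sigma>'
    using max[OF s that n1(2-5), of i j k l] by (simp add: e_def s'_def)
  have "s \<noteq> t0"
  proof
    assume eq: "s = t0"
    have "e (i, j, k, l) (s, \<sigma>, \<alpha>, \<beta>, \<gamma>, \<eta>) \<le> 2 * \<Phi>"
      using \<Phi>(2)[OF n1(2,3), of i j] \<Phi>(2)[OF n1(4,5), of k l] by (simp add: e_def eq)
    then show False using pos by (simp add: B_def eq)
  qed
  moreover have "s \<noteq> t0 / 2"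
  proof
    assume eq: "s = t0 / 2"
    \<comment> \<open>All four differences are estimated by the weaker bound at the inner radius, s'
      = 3/2 t0, each by 3/2 W C (- t0).\<close>
    have "C * s' \<le> C * s" using C rng s by (intro mult_left_mono) auto
    then have "W * - (C * s) \<le> W * - (C * s')" using W by (intro mult_left_mono) auto
    then have "e (i, j, k, l) (s, \<sigma>, \<alpha>, \<beta>, \<gamma>, \<eta>) \<le> 4 * (W * - (C * s'))"
      using Y_diff[OF rng(1,2) n1(2,3), of i j] Y_diff[OF rng(1,2) n1(1,1), of True False]
        Y_diff[OF rng(3,4) n1(4,5), of k l] Y_diff[OF rng(3,4) n1(1,1), of False True]
      by (simp add: e_def s'_def[symmetric])
    also have "\<dots> = 6 * (W * C * - t0)" by (simp add: s'_def eq)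
    also have "\<dots> \<le> 8 * (W * C * - t0)" using W C t0 by (intro mult_right_mono mult_nonneg_nonneg) auto
    finally have 1: "e (i, j, k, l) (s, \<sigma>, \<alpha>, \<beta>, \<gamma>, \<eta>) \<le> 8 * (W * C * - t0)" .
    have "(- t0) * (- t0) \<le> (- t0) * 2" using t0 by (intro mult_left_mono) auto
    then have "L * ((- t0) * (- t0)) \<le> L * ((- t0) * 2)" by (rule mult_left_mono) (use L in auto)
    moreover have "B s = 2 * \<Phi> + 8 * (W * C * - t0) + (L * ((- t0) * 2) - L * ((- t0) * (- t0))) / 4"
      by (simp add: B_def eq A_def power2_eq_square field_simps)
    moreover have "z \<le> B s" if "x \<le> y" "B s = 2 * \<Phi> + z + (y - x) / 4" for x y z
      using that \<Phi>(1) by (simp add: field_simps)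
    ultimately have "8 * (W * C * - t0) \<le> B s" by blast
    then show False using 1 pos by simp
  qed
  ultimately have s2: "t0 < s" "s < t0 / 2" using s by auto
  have es: "0 < exp s" "exp s < 1" "0 < exp s'" "exp s' < 1" using rng by auto
  let ?U = "\<lambda>i t \<sigma>. u i (exp t *\<^sub>R \<sigma>)"
  let ?f = "\<lambda>i t \<sigma>. f (?U i t \<sigma>)"
  let ?R = "\<lambda>i t \<sigma>. radlap (G i) (H i) (exp t) \<sigma>"
  have U\<alpha>: "?U i' s \<alpha>' \<le> ?U i s \<alpha>" if "norm \<alpha>' = 1" for i' \<alpha>'
    using Y\<alpha>[OF that, of i'] by (simp add: Y_def)
  have U\<beta>: "?U j s \<beta> \<le> ?U j' s \<beta>'" if "norm \<beta>' = 1" for j' \<beta>'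
    using Y\<beta>[OF that, of j'] by (simp add: Y_def)
  have U\<gamma>: "?U k' s' \<gamma>' \<le> ?U k s' \<gamma>" if "norm \<gamma>' = 1" for k' \<gamma>'
    using Y\<gamma>[OF that, of k'] by (simp add: Y_def)
  have U\<eta>: "?U l s' \<eta> \<le> ?U l' s' \<eta>'" if "norm \<eta>' = 1" for l' \<eta>'
    using Y\<eta>[OF that, of l'] by (simp add: Y_def)
  have R\<alpha>: "?f i s \<alpha> \<le> ?R i s \<alpha>" by (rule spherical_max_single(1)[OF sol es(1,2) n1(2) U\<alpha>])
  have R\<beta>: "?R j s \<beta> \<le> ?f j s \<beta>" by (rule spherical_max_single(2)[OF sol es(1,2) n1(3) U\<beta>])
  have R\<gamma>: "?f k s' \<gamma> \<le> ?R k s' \<gamma>" by (rule spherical_max_single(1)[OF sol es(3,4) n1(4) U\<gamma>])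
  have R\<eta>: "?R l s' \<eta> \<le> ?f l s' \<eta>" by (rule spherical_max_single(2)[OF sol es(3,4) n1(5) U\<eta>])
  define q q' where "q = exp (\<kappa> * s) * (exp s)\<^sup>2" and "q' = exp (\<kappa> * s') * (exp s')\<^sup>2"
  have q: "0 \<le> q" "q \<le> W * 1" "0 \<le> q'" "q' \<le> W * 1"
    unfolding q_def q'_def using rng W es t0 by (auto simp del: mult_1_right intro!: mult_mono power_le_one exp_kappa_le)
  have R\<sigma>: "q * (?f True s \<sigma> - ?R True s \<sigma> - (?f False s \<sigma> - ?R False s \<sigma>))
    - q' * (?f True s' \<sigma> - ?R True s' \<sigma> - (?f False s' \<sigma> - ?R False s' \<sigma>)) \<le> 0"
  proof -
    \<comment> \<open>An index is a pair (solution, radius), with \<open>snd k\<close> true for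
      \<open>s\<close> and false for \<open>s'\<close>. The sign is + exactly when the components
      agree, which encodes w at \<open>s\<close> minus w at \<open>s'\<close>.\<close>
    have "(\<Sum>k\<in>(UNIV::(bool \<times> bool) set).
        (if fst k = snd k then 1 else - 1) * exp (\<kappa> * (if snd k then s else s')) * (exp (if snd k then s else s'))\<^sup>2 *
        (f (u (fst k) (exp (if snd k then s else s') *\<^sub>R \<sigma>)) -
          radlap (G (fst k)) (H (fst k)) (exp (if snd k then s else s')) \<sigma>)) \<le> 0"
    proof (rule spherical_max[where r = "\<lambda>k. exp (if snd k then s else s')"
          and c = "\<lambda>k. (if fst k = snd k then 1 else - 1) * exp (\<kappa> * (if snd k then s else s'))"
          and u = "\<lambda>k. u (fst k)" and G = "\<lambda>k. G (fst k)" and H = "\<lambda>k. H (fst k)"])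
      fix \<sigma>' :: 'a assume "norm \<sigma>' = 1"
      from Y\<sigma>[OF this]
      show "(\<Sum>k\<in>(UNIV::(bool \<times> bool) set). (if fst k = snd k then 1 else - 1) * exp (\<kappa> * (if snd k then s else s')) *
            u (fst k) (exp (if snd k then s else s') *\<^sub>R \<sigma>'))
        \<le> (\<Sum>k\<in>(UNIV::(bool \<times> bool) set). (if fst k = snd k then 1 else - 1) * exp (\<kappa> * (if snd k then s else s')) *
            u (fst k) (exp (if snd k then s else s') *\<^sub>R \<sigma>))"
        unfolding UNIV_Times_UNIV[symmetric] sum.cartesian_product'[symmetric]
        by (simp add: UNIV_bool Y_def)
    qed (use sol es n1 in auto)
    then show ?thesis
      unfolding UNIV_Times_UNIV[symmetric] sum.cartesian_product'[symmetric]
      by (simp add: UNIV_bool q_def q'_def algebra_simps)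
  qed
  have "Y2 i s \<alpha> - Y2 j s \<beta> + (Y2 True s \<sigma> - Y2 False s \<sigma>) +
     (Y2 k s' \<gamma> - Y2 l s' \<eta> - (Y2 True s' \<sigma> - Y2 False s' \<sigma>)) - (- 2 * L) \<le> 0"
    unfolding s'_def
  proof (rule second_derivative_at_max[where e = "min (s - t0) (t0 / 2 - s)" and x = s and
      g = "\<lambda>x. e (i, j, k, l) (x, \<sigma>, \<alpha>, \<beta>, \<gamma>, \<eta>) - B x" and
      g' = "\<lambda>x. Y1 i x \<alpha> - Y1 j x \<beta> + (Y1 True x \<sigma> - Y1 False x \<sigma>) +
       ((- Y1 k (2 * t0 - x) \<gamma>) - (- Y1 l (2 * t0 - x) \<eta>) -
        ((- Y1 True (2 * t0 - x) \<sigma>) - (- Y1 False (2 * t0 - x) \<sigma>))) - (A - L * (2 * (x - t0)))"])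
    fix x assume "\<bar>x - s\<bar> < min (s - t0) (t0 / 2 - s)"
    then have x: "t0 \<le> x" "x \<le> t0 / 2" by auto
    then have x2: "x < 0" "2 * t0 - x < 0" using t0 by auto
    have dB: "(B has_real_derivative (A - L * (2 * (x - t0)))) (at x)"
      unfolding B_def by (auto intro!: derivative_eq_intros)
    show "((\<lambda>x. e (i, j, k, l) (x, \<sigma>, \<alpha>, \<beta>, \<gamma>, \<eta>) - B x) has_real_derivative
       Y1 i x \<alpha> - Y1 j x \<beta> + (Y1 True x \<sigma> - Y1 False x \<sigma>) +
       ((- Y1 k (2 * t0 - x) \<gamma>) - (- Y1 l (2 * t0 - x) \<eta>) -
        ((- Y1 True (2 * t0 - x) \<sigma>) - (- Y1 False (2 * t0 - x) \<sigma>))) - (A - L * (2 * (x - t0)))) (at x)"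
      unfolding e_def split_beta fst_conv snd_conv
      by (intro DERIV_diff DERIV_add dB Y_deriv(1) Y_reflected_deriv(1) x2 n1)
    show "e (i, j, k, l) (x, \<sigma>, \<alpha>, \<beta>, \<gamma>, \<eta>) - B x \<le> e (i, j, k, l) (s, \<sigma>, \<alpha>, \<beta>, \<gamma>, \<eta>) - B s"
      by (rule max[OF x n1])
  next
    have dB: "((\<lambda>x. A - L * (2 * (x - t0))) has_real_derivative (- 2 * L)) (at s)"
      by (auto intro!: derivative_eq_intros)
    have x2: "s < 0" "2 * t0 - s < 0" using rng by (auto simp: s'_def)
    show "((\<lambda>x. Y1 i x \<alpha> - Y1 j x \<beta> + (Y1 True x \<sigma> - Y1 False x \<sigma>) +
       ((- Y1 k (2 * t0 - x) \<gamma>) - (- Y1 l (2 * t0 - x) \<eta>) -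
        ((- Y1 True (2 * t0 - x) \<sigma>) - (- Y1 False (2 * t0 - x) \<sigma>))) - (A - L * (2 * (x - t0)))) has_real_derivative
       Y2 i s \<alpha> - Y2 j s \<beta> + (Y2 True s \<sigma> - Y2 False s \<sigma>) +
     (Y2 k (2 * t0 - s) \<gamma> - Y2 l (2 * t0 - s) \<eta> - (Y2 True (2 * t0 - s) \<sigma> - Y2 False (2 * t0 - s) \<sigma>)) - (- 2 * L)) (at s)"
      by (intro DERIV_diff DERIV_add dB Y_deriv(2) Y_reflected_deriv(2) x2 n1)
  qed (use s2 in auto)
  then have dd: "Y2 i s \<alpha> - Y2 j s \<beta> + (Y2 True s \<sigma> - Y2 False s \<sigma>) +
     (Y2 k s' \<gamma> - Y2 l s' \<eta> - (Y2 True s' \<sigma> - Y2 False s' \<sigma>)) + 2 * L \<le> 0" by simp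
  have Y2_eq: "Y2 i t \<sigma> = exp (\<kappa> * t) * \<kappa>\<^sup>2 * ?U i t \<sigma> + exp (\<kappa> * t) * (exp t)\<^sup>2 * ?R i t \<sigma>" for i t \<sigma>
    by (simp add: Y2_def algebra_simps)
  \<comment> \<open>The maximum is paired with solution \<open>False\<close> and the minimum with
    \<open>True\<close>. At \<open>s'\<close>, where w enters with the opposite sign, the pairing is
    exchanged. The values of \<open>f\<close> are grouped below in the same way.\<close>
  have "0 \<le> exp (\<kappa> * s) * \<kappa>\<^sup>2 * ((?U i s \<alpha> - ?U False s \<sigma>) + (?U True s \<sigma> - ?U j s \<beta>))"
    using U\<alpha>[OF n1(1), of False] U\<beta>[OF n1(1), of True] by (intro mult_nonneg_nonneg) auto
  moreover have "q * (?f i s \<alpha> - ?f j s \<beta>) \<le> q * (?R i s \<alpha> - ?R j s \<beta>)"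
    using R\<alpha> R\<beta> q by (intro mult_left_mono) auto
  ultimately have 1: "q * (?f i s \<alpha> - ?f j s \<beta>) + q * (?R True s \<sigma> - ?R False s \<sigma>)
      \<le> Y2 i s \<alpha> - Y2 j s \<beta> + (Y2 True s \<sigma> - Y2 False s \<sigma>)"
    unfolding Y2_eq q_def by (simp add: algebra_simps)
  have "0 \<le> exp (\<kappa> * s') * \<kappa>\<^sup>2 * ((?U k s' \<gamma> - ?U True s' \<sigma>) + (?U False s' \<sigma> - ?U l s' \<eta>))"
    using U\<gamma>[OF n1(1), of True] U\<eta>[OF n1(1), of False] by (intro mult_nonneg_nonneg) auto
  moreover have "q' * (?f k s' \<gamma> - ?f l s' \<eta>) \<le> q' * (?R k s' \<gamma> - ?R l s' \<eta>)"
    using R\<gamma> R\<eta> q by (intro mult_left_mono) auto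
  ultimately have 2: "q' * (?f k s' \<gamma> - ?f l s' \<eta>) - q' * (?R True s' \<sigma> - ?R False s' \<sigma>)
      \<le> Y2 k s' \<gamma> - Y2 l s' \<eta> - (Y2 True s' \<sigma> - Y2 False s' \<sigma>)"
    unfolding Y2_eq q'_def by (simp add: algebra_simps)
  have low: "- (K * C) \<le> f x - f y" if "y \<le> x" "x - y \<le> C" for x y
  proof -
    have "K * (x - y) \<le> K * C" using that K by (intro mult_left_mono) auto
    then show ?thesis using one_sided_lipschitz[OF that(1)] by simp
  qed
  have scale: "- (2 * (W * (K * C))) \<le> p * X" if "0 \<le> p" "p \<le> W * 1" "- (2 * (K * C)) \<le> X" for p X
  proof -
    have "p * (2 * (K * C)) \<le> W * (2 * (K * C))" using that K C by (intro mult_right_mono) auto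
    moreover have "p * - (2 * (K * C)) \<le> p * X" using that by (intro mult_left_mono) auto
    ultimately show ?thesis by simp
  qed
  have "- (2 * (K * C)) \<le> (?f i s \<alpha> - ?f False s \<sigma>) + (?f True s \<sigma> - ?f j s \<beta>)"
    using low[OF U\<alpha>[OF n1(1)] u_diff(2)[OF rng(1,2) n1(2,1)], of False]
      low[OF U\<beta>[OF n1(1)] u_diff(2)[OF rng(1,2) n1(1,3)], of True] by linarith
  from scale[OF q(1,2) this] have 3: "- (2 * (W * (K * C))) \<le> q * (?f i s \<alpha> - ?f j s \<beta>) + q * (?f True s \<sigma> - ?f False s \<sigma>)"
    by (simp add: algebra_simps)
  have "- (2 * (K * C)) \<le> (?f k s' \<gamma> - ?f True s' \<sigma>) + (?f False s' \<sigma> - ?f l s' \<eta>)"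
    using low[OF U\<gamma>[OF n1(1)] u_diff(2)[OF rng(3,4) n1(4,1)], of True]
      low[OF U\<eta>[OF n1(1)] u_diff(2)[OF rng(3,4) n1(1,5)], of False] by linarith
  from scale[OF q(3,4) this] have 4: "- (2 * (W * (K * C))) \<le> q' * (?f k s' \<gamma> - ?f l s' \<eta>) - q' * (?f True s' \<sigma> - ?f False s' \<sigma>)"
    by (simp add: algebra_simps)
  have 5: "q * (?f True s \<sigma> - ?f False s \<sigma>) - q' * (?f True s' \<sigma> - ?f False s' \<sigma>)
      \<le> q * (?R True s \<sigma> - ?R False s \<sigma>) - q' * (?R True s' \<sigma> - ?R False s' \<sigma>)"
    using R\<sigma> by (simp add: algebra_simps)
  have "L = 4 * (W * (K * C)) + 1" by (simp add: L_def)
  moreover have "0 \<le> W * (K * C)" using W K C by simp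
  ultimately show False using 1 2 3 4 5 dd by linarith
qed

text \<open>With the same extremal choice \<open>(i, j)\<close>, \<open>(\<alpha>, \<beta>)\<close>
  before and after reflection, \<open>e\<close> starts exactly at the initial value 2 \<Phi> of the
  barrier. The derivatives of the extremal terms cancel against their reflections, while those of w
  add up, so the slope of the barrier bounds twice the derivative of exp(\<kappa> t) w.\<close>

lemma radial_derivative_diff_le:
  assumes \<sigma>: "norm \<sigma> = 1"
  shows "(G True (exp t0 *\<^sub>R \<sigma>) - G False (exp t0 *\<^sub>R \<sigma>)) \<bullet> \<sigma> \<le> A * W + 2 * \<bar>\<kappa>\<bar> * C"
proof -
  define S where "S = sphere (0::'a) 1"
  have Sx: "norm (fst x) = 1" "norm (snd x) = 1" if "x \<in> S \<times> S" for x using that by (auto simp: S_def)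
  have "compact (S \<times> S)" unfolding S_def by (intro compact_Times compact_sphere)
  moreover have "S \<times> S \<noteq> {}" using \<sigma> by (auto simp: S_def)
  moreover have "continuous_on (S \<times> S) (\<lambda>x. Y (fst c) t0 (fst x) - Y (snd c) t0 (snd x))" for c
    by (intro continuous_intros Y_continuous Sx t0)
  ultimately obtain c x where cx: "x \<in> S \<times> S"
    "\<And>c' x'. x' \<in> S \<times> S \<Longrightarrow> Y (fst c') t0 (fst x') - Y (snd c') t0 (snd x') \<le> Y (fst c) t0 (fst x) - Y (snd c) t0 (snd x)"
    using finite_compact_attains_sup[where F = "\<lambda>c x. Y (fst c) t0 (fst x) - Y (snd c) t0 (snd x)" and Z = "S \<times> S",
        OF finite[of UNIV] UNIV_not_empty] by (metis UNIV_I)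
  obtain i j where c: "c = (i, j)" by (cases c)
  obtain \<alpha> \<beta> where x: "x = (\<alpha>, \<beta>)" by (cases x)
  have n: "norm \<alpha> = 1" "norm \<beta> = 1" using cx(1) by (auto simp: x S_def)
  define \<Phi> where "\<Phi> = Y i t0 \<alpha> - Y j t0 \<beta>"
  have \<Phi>: "Y i' t0 \<alpha>' - Y j' t0 \<beta>' \<le> \<Phi>" if "norm \<alpha>' = 1" "norm \<beta>' = 1" for i' j' \<alpha>' \<beta>'
    using cx(2)[of "(\<alpha>', \<beta>')" "(i', j')"] that by (simp add: S_def c x \<Phi>_def)
  have "\<Phi> \<ge> 0" using \<Phi>[OF \<sigma> \<sigma>, of True True] by simp
  note barrier = e_barrier[OF this \<Phi>]
  have d: "Y1 i t0 \<alpha> - Y1 j t0 \<beta> + (Y1 True t0 \<sigma> - Y1 False t0 \<sigma>) +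
       ((- Y1 i (2 * t0 - t0) \<alpha>) - (- Y1 j (2 * t0 - t0) \<beta>) -
        ((- Y1 True (2 * t0 - t0) \<sigma>) - (- Y1 False (2 * t0 - t0) \<sigma>))) \<le> A"
  proof (rule derivative_le[where d = "- t0 / 2"])
    have x2: "2 * t0 - t0 < 0" using t0 by simp
    show "((\<lambda>x. e (i, j, i, j) (x, \<sigma>, \<alpha>, \<beta>, \<alpha>, \<beta>)) has_real_derivative
      Y1 i t0 \<alpha> - Y1 j t0 \<beta> + (Y1 True t0 \<sigma> - Y1 False t0 \<sigma>) +
       ((- Y1 i (2 * t0 - t0) \<alpha>) - (- Y1 j (2 * t0 - t0) \<beta>) -
        ((- Y1 True (2 * t0 - t0) \<sigma>) - (- Y1 False (2 * t0 - t0) \<sigma>)))) (at t0)"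
      unfolding e_def split_beta fst_conv snd_conv
      by (intro DERIV_diff DERIV_add Y_deriv(1) Y_reflected_deriv(1) x2 t0(2) n \<sigma>)
    show "0 < - t0 / 2" using t0 by simp
    fix h assume h: "0 < h" "h < - t0 / 2"
    have "e (i, j, i, j) (t0 + h, \<sigma>, \<alpha>, \<beta>, \<alpha>, \<beta>) \<le> 2 * \<Phi> + A * (t0 + h - t0) - L * (t0 + h - t0)\<^sup>2"
      by (rule barrier) (use h n \<sigma> in auto)
    also have "\<dots> \<le> 2 * \<Phi> + A * h" using L by simp
    finally show "e (i, j, i, j) (t0 + h, \<sigma>, \<alpha>, \<beta>, \<alpha>, \<beta>) \<le> e (i, j, i, j) (t0, \<sigma>, \<alpha>, \<beta>, \<alpha>, \<beta>) + A * h"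
      by (simp add: e_def \<Phi>_def)
  qed
  let ?d = "(G True (exp t0 *\<^sub>R \<sigma>) - G False (exp t0 *\<^sub>R \<sigma>)) \<bullet> \<sigma>"
  let ?w = "u True (exp t0 *\<^sub>R \<sigma>) - u False (exp t0 *\<^sub>R \<sigma>)"
  have "exp (\<kappa> * t0) * (\<kappa> * ?w + exp t0 * ?d) \<le> A / 2"
    using d by (simp add: Y1_def inner_diff_left algebra_simps)
  then have "\<kappa> * ?w + exp t0 * ?d \<le> exp (- (\<kappa> * t0)) * (A / 2)"
    by (simp add: exp_minus field_simps)
  also have "\<dots> \<le> W * (A / 2)"
    using exp_kappa_le[of t0] t0 W C L by (intro mult_right_mono) (auto simp: A_def)
  finally have 1: "exp t0 * ?d \<le> W * (A / 2) - \<kappa> * ?w" by simp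
  have "\<bar>?w\<bar> \<le> C"
    using u_diff(2)[of t0 \<sigma> \<sigma> True False] u_diff(2)[of t0 \<sigma> \<sigma> False True] t0 \<sigma> by simp
  then have "\<bar>\<kappa>\<bar> * \<bar>?w\<bar> \<le> \<bar>\<kappa>\<bar> * C" by (intro mult_left_mono) auto
  then have "- (\<kappa> * ?w) \<le> \<bar>\<kappa>\<bar> * C" unfolding abs_mult[symmetric] by linarith
  with 1 have 2: "exp t0 * ?d \<le> W * (A / 2) + \<bar>\<kappa>\<bar> * C" by simp
  have X: "0 \<le> W * (A / 2) + \<bar>\<kappa>\<bar> * C" using W L C by (simp add: A_def)
  show ?thesis
  proof (cases "?d \<ge> 0")
    case True
    have "1 / 2 \<le> exp t0" using exp_ge_add_one_self[of t0] t0 by linarith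
    then have "1 / 2 * ?d \<le> exp t0 * ?d" using True by (intro mult_right_mono) auto
    then show ?thesis using 2 by (simp add: algebra_simps)
  next
    case False
    then show ?thesis using X by (simp add: algebra_simps)
  qed
qed

text \<open>Expresses the bound without locale constants, so that interpretations at different
  \<open>t0\<close> share one and the same number.\<close>

lemma radial_derivative_diff_le_explicit:
  assumes "norm \<sigma> = 1" "k = (real DIM('a) - 2) / 2" "w = exp \<bar>k\<bar>"
  shows "(G True (exp t0 *\<^sub>R \<sigma>) - G False (exp t0 *\<^sub>R \<sigma>)) \<bullet> \<sigma>
    \<le> (16 * w * C + (4 * w * K * C + 1)) * w + 2 * \<bar>k\<bar> * C"
  using radial_derivative_diff_le[OF assms(1)] unfolding A_def L_def W_def \<kappa>_def assms(2,3) .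

end

section \<open>The gradient bound\<close>

lemma frechet_gradient:
  assumes "u differentiable (at x)"
  shows "(u has_derivative (\<lambda>h. gradient u x \<bullet> h)) (at x)"
proof -
  have D: "(u has_derivative frechet_derivative u (at x)) (at x)"
    using assms frechet_derivative_works by blast
  interpret linear "frechet_derivative u (at x)" using has_derivative_linear[OF D] .
  have "frechet_derivative u (at x) h = gradient u x \<bullet> h" for h
  proof -
    have "frechet_derivative u (at x) h = frechet_derivative u (at x) (\<Sum>b\<in>Basis. (h \<bullet> b) *\<^sub>R b)"
      by (simp add: euclidean_representation)
    also have "\<dots> = (\<Sum>b\<in>Basis. (h \<bullet> b) * partial_deriv b u x)"
      by (simp only: sum scale partial_deriv_def) simp
    also have "\<dots> = gradient u x \<bullet> h"
      by (simp add: gradient_def inner_sum_left inner_commute[of h] mult.commute)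
    finally show ?thesis .
  qed
  then show ?thesis using D by (metis (no_types, lifting) has_derivative_eq_rhs ext)
qed

text \<open>The limits at individual boundary points become uniform by compactness: the closure of
  {u < c} in the ball is compact and misses the unit sphere, so its largest norm, if it is nonempty,
  is below 1.\<close>

lemma large_solution_sol:
  assumes "large_solution f (ball 0 1) u"
  shows "blowup_solution f u (gradient u) (\<lambda>x. frechet_derivative (gradient u) (at x))"
  unfolding blowup_solution_def
proof (intro conjI ballI allI)
  have C2: "C2_on (ball 0 1) u" and eq: "\<And>x. x \<in> ball 0 1 \<Longrightarrow> laplacian u x = f (u x)"
    and lim: "\<And>x0. x0 \<in> frontier (ball 0 1) \<Longrightarrow> filterlim u at_top (at x0 within ball 0 1)"
    using assms by (auto simp: large_solution_def classical_solution_def)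
  fix x :: 'a assume x: "x \<in> ball 0 1"
  show "(u has_derivative (\<bullet>) (gradient u x)) (at x)"
    using frechet_gradient[of u x] C2 x by (auto simp: C2_on_def C1_on_def)
  have pd: "(partial_deriv b u has_derivative frechet_derivative (partial_deriv b u) (at x)) (at x)"
    if "b \<in> Basis" for b
    using C2 x that by (auto simp: C2_on_def C1_on_def frechet_derivative_works[symmetric])
  have gd: "(gradient u has_derivative (\<lambda>h. \<Sum>b\<in>Basis. frechet_derivative (partial_deriv b u) (at x) h *\<^sub>R b)) (at x)"
    unfolding gradient_def[abs_def] by (intro has_derivative_sum has_derivative_scaleR_left pd)
  from differentiableI[OF this] show "(gradient u has_derivative frechet_derivative (gradient u) (at x)) (at x)"
    by (simp add: frechet_derivative_works[symmetric])
  have "frechet_derivative (gradient u) (at x) = (\<lambda>h. \<Sum>b\<in>Basis. frechet_derivative (partial_deriv b u) (at x) h *\<^sub>R b)"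
    using frechet_derivative_at[OF gd] by simp
  then have "(\<Sum>b\<in>Basis. frechet_derivative (gradient u) (at x) b \<bullet> b) = laplacian u x"
    by (simp add: laplacian_def partial_deriv_def)
  then show "(\<Sum>b\<in>Basis. frechet_derivative (gradient u) (at x) b \<bullet> b) = f (u x)"
    using eq[OF x] by simp
next
  fix c
  define E where "E = closure {x \<in> ball 0 1. u x < c}"
  have Esub: "E \<subseteq> cball 0 1"
    unfolding E_def by (rule closure_minimal) auto
  then have "compact E" unfolding E_def by (metis bounded_subset compact_eq_bounded_closed bounded_cball closed_closure)
  have lt: "norm x < 1" if xE: "x \<in> E" for x
  proof (rule ccontr)
    assume "\<not> norm x < 1"
    then have "norm x = 1" using Esub xE by force
    then have "filterlim u at_top (at x within ball 0 1)"
      using assms by (simp add: large_solution_def frontier_ball)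
    then have "eventually (\<lambda>y. c \<le> u y) (at x within ball 0 1)" by (simp add: filterlim_at_top)
    then obtain d where d: "d > 0" "\<And>y. y \<in> ball 0 1 \<Longrightarrow> y \<noteq> x \<Longrightarrow> dist y x < d \<Longrightarrow> c \<le> u y"
      unfolding eventually_at by blast
    obtain y where "y \<in> ball 0 1" "u y < c" "dist y x < d"
      using xE d(1) unfolding E_def closure_approachable by blast
    then show False using d(2)[of y] \<open>norm x = 1\<close> by force
  qed
  show "\<exists>r<1. \<forall>x. r \<le> norm x \<longrightarrow> norm x < 1 \<longrightarrow> c \<le> u x"
  proof (cases "E = {}")
    case True
    then have "\<not> u x < c" if "norm x < 1" for x using that by (auto simp: E_def)
    then show ?thesis by (intro exI[of _ 0]) (simp add: not_less)
  next
    case False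
    then obtain y where y: "y \<in> E" "\<And>x. x \<in> E \<Longrightarrow> norm x \<le> norm y"
      using continuous_attains_sup[OF \<open>compact E\<close> False continuous_on_norm_id] by auto
    have "c \<le> u x" if "(norm y + 1) / 2 \<le> norm x" "norm x < 1" for x
    proof (rule ccontr)
      assume "\<not> c \<le> u x"
      then have "x \<in> E" using that closure_subset[of "{x \<in> ball 0 1. u x < c}"] by (auto simp: E_def)
      then show False using y(2)[of x] lt[OF y(1)] that by simp
    qed
    then show ?thesis using lt[OF y(1)] by (intro exI[of _ "(norm y + 1) / 2"]) auto
  qed
qed

lemma norm_le_radial_tangential:
  fixes g \<sigma> :: "'a::real_inner"
  assumes \<sigma>: "norm \<sigma> = 1" and rad: "\<bar>g \<bullet> \<sigma>\<bar> \<le> B"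
    and tan: "\<And>\<omega>. norm \<omega> = 1 \<Longrightarrow> \<sigma> \<bullet> \<omega> = 0 \<Longrightarrow> g \<bullet> \<omega> \<le> B'" and B': "0 \<le> B'"
  shows "norm g \<le> B + B'"
proof -
  define h where "h = g - (g \<bullet> \<sigma>) *\<^sub>R \<sigma>"
  have orth: "\<sigma> \<bullet> h = 0" using \<sigma> by (simp add: h_def inner_diff_right norm_eq_1 inner_commute)
  have "norm h \<le> B'"
  proof (cases "h = 0")
    case False
    define \<omega> where "\<omega> = h /\<^sub>R norm h"
    have "norm \<omega> = 1" "\<sigma> \<bullet> \<omega> = 0" using False orth by (auto simp: \<omega>_def)
    moreover have "g \<bullet> \<omega> = norm h"
    proof -
      have "g \<bullet> h = h \<bullet> h" using orth by (simp add: h_def inner_diff_left inner_commute algebra_simps)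
      then show ?thesis using False by (simp add: \<omega>_def dot_square_norm power2_eq_square)
    qed
    ultimately show ?thesis using tan by metis
  qed (use B' in simp)
  moreover have "norm g \<le> norm ((g \<bullet> \<sigma>) *\<^sub>R \<sigma>) + norm h"
    using norm_triangle_ineq[of "(g \<bullet> \<sigma>) *\<^sub>R \<sigma>" h] by (simp add: h_def)
  ultimately show ?thesis using rad \<sigma> by simp
qed

text \<open>The tangential part of each gradient is bounded by itself; the radial part is bounded
  only for the difference. Away from the boundary continuity on a compact ball suffices.\<close>

theorem gradient_difference_bounded:
  fixes u :: "bool \<Rightarrow> 'a::euclidean_space \<Rightarrow> real"
  assumes sol: "\<And>i. blowup_solution f (u i) (G i) (H i)"
    and K: "0 \<le> K" and one_sided_lipschitz: "\<And>s t. t \<le> s \<Longrightarrow> - K * (s - t) \<le> f s - f t"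
    and f_nonneg: "\<And>t. t > a \<Longrightarrow> f t \<ge> 0"
  obtains M where "\<And>x. norm x < 1 \<Longrightarrow> norm (G True x - G False x) \<le> M"
proof -
  have "DIM('a) \<ge> 1" using DIM_positive[where 'a='a] by linarith
  then obtain \<rho> :: "real \<Rightarrow> real" where \<rho>: "\<rho> 0 = 1" "\<And>\<tau>. - 1/2 \<le> \<tau> \<Longrightarrow> \<tau> \<le> 0 \<Longrightarrow> 0 < \<rho> \<tau>"
    "\<And>\<tau>. - 1/2 \<le> \<tau> \<Longrightarrow> \<tau> \<le> 0 \<Longrightarrow> (\<rho> has_real_derivative \<rho> \<tau> ^ (DIM('a) - 1)) (at \<tau>)"
    by (rule radial_coordinate_exists) blast
  interpret comparison \<rho> "DIM('a)" f K a
    by unfold_locales (use \<rho> \<open>DIM('a) \<ge> 1\<close> K one_sided_lipschitz f_nonneg in auto)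
  have "\<exists>C \<tau>0. 0 \<le> C \<and> T \<le> \<tau>0 \<and> \<tau>0 < 0 \<and> (\<forall>\<tau> \<sigma> \<sigma>'. \<tau>0 \<le> \<tau> \<longrightarrow> \<tau> < 0 \<longrightarrow> norm \<sigma> = 1 \<longrightarrow> norm \<sigma>' = 1 \<longrightarrow>
      u i (\<rho> \<tau> *\<^sub>R \<sigma>) - u j (\<rho> \<tau> *\<^sub>R \<sigma>') \<le> C * b \<tau>)" for i j
    by (rule diff_le[OF sol[of i] sol[of j] refl]) blast
  then obtain Cf tf where Cf: "\<And>i j. 0 \<le> Cf i j" "\<And>i j. T \<le> tf i j" "\<And>i j. tf i j < 0"
    "\<And>i j \<tau> \<sigma> \<sigma>'. tf i j \<le> \<tau> \<Longrightarrow> \<tau> < 0 \<Longrightarrow> norm \<sigma> = 1 \<Longrightarrow> norm \<sigma>' = 1 \<Longrightarrow>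
      u i (\<rho> \<tau> *\<^sub>R \<sigma>) - u j (\<rho> \<tau> *\<^sub>R \<sigma>') \<le> Cf i j * b \<tau>"
    by metis
  define \<tau>0 where "\<tau>0 = max (max (tf True True) (tf True False)) (max (tf False True) (tf False False))"
  \<comment> \<open>One constant for all four ordered pairs of solutions, including equal ones; the
    denominator turns \<open>- \<tau>\<close> into \<open>1 - r\<close> through
    \<open>rho_dist\<close>.\<close>
  define C where "C = (\<Sum>i\<in>UNIV. \<Sum>j\<in>UNIV. Cf i j) / \<rho> (- 1/2) ^ (DIM('a) - 1)"
  have t0: "T \<le> \<tau>0" "\<tau>0 < 0" "tf i j \<le> \<tau>0" for i j
    using Cf(2,3) by (cases i; cases j; auto simp: \<tau>0_def le_max_iff_disj)+
  have T4: "- 1/4 \<le> T" "T < 0" using T by auto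
  have c: "0 < \<rho> (- 1/2) ^ (DIM('a) - 1)" using rho_pos[of "- 1/2"] by simp
  have C0: "0 \<le> C" using Cf(1) c by (auto simp: C_def intro!: divide_nonneg_pos sum_nonneg)
  have diff: "u i (r *\<^sub>R \<alpha>) - u j (r *\<^sub>R \<beta>) \<le> C * (1 - r)"
    if r: "\<rho> \<tau>0 \<le> r" "r < 1" and n: "norm \<alpha> = 1" "norm \<beta> = 1" for i j r \<alpha> \<beta>
  proof -
    obtain \<tau> where \<tau>: "\<tau>0 \<le> \<tau>" "\<tau> < 0" "\<rho> \<tau> = r"
      by (rule rho_surj[of \<tau>0 r]) (use t0 T4 r in auto)
    have "u i (r *\<^sub>R \<alpha>) - u j (r *\<^sub>R \<beta>) \<le> Cf i j * b \<tau>"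
      using Cf(4)[of i j \<tau> \<alpha> \<beta>] \<tau> t0(3)[of i j] n by simp
    also have "\<dots> \<le> (\<Sum>i\<in>UNIV. \<Sum>j\<in>UNIV. Cf i j) * - \<tau>"
    proof (rule mult_mono)
      show "Cf i j \<le> (\<Sum>i\<in>UNIV. \<Sum>j\<in>UNIV. Cf i j)"
        using Cf(1)[of True True] Cf(1)[of True False] Cf(1)[of False True] Cf(1)[of False False]
        by (cases i; cases j) (simp_all add: UNIV_bool)
      show "b \<tau> \<le> - \<tau>" "0 \<le> b \<tau>" using b_bounds[of \<tau>] \<tau> t0 by auto
      show "0 \<le> (\<Sum>i\<in>UNIV. \<Sum>j\<in>UNIV. Cf i j)" using Cf(1) by (intro sum_nonneg) auto
    qed
    also have "\<dots> = C * (- \<tau> * \<rho> (- 1/2) ^ (DIM('a) - 1))"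
      using rho_pos[of "- 1/2", THEN less_imp_neq] by (auto simp: C_def)
    also have "\<dots> \<le> C * (1 - \<rho> \<tau>)"
      using \<tau> t0 T4 C0 by (intro mult_left_mono rho_dist) auto
    finally show ?thesis by (simp add: \<tau>(3))
  qed
  have rt0: "0 < \<rho> \<tau>0" "\<rho> \<tau>0 < 1" using rho_pos[of \<tau>0] rho_less_1[of \<tau>0] t0 T4 by auto
  define k w where "k = (real DIM('a) - 2) / 2" and "w = exp \<bar>k\<bar>"
  define B where "B = (16 * w * C + (4 * w * K * C + 1)) * w + 2 * \<bar>k\<bar> * C"
  \<comment> \<open>For r \<ge> r1 the number t0 = ln r satisfies both range conditions of
    \<open>reflection\<close>: t0 \<ge> - 1/2, and exp(3/2 t0) \<ge> \<rho> \<tau>0, so that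
    \<open>diff\<close> reaches the inner end of the reflected shell.\<close>
  define r1 where "r1 = exp (max (- 1/2) (2/3 * ln (\<rho> \<tau>0)))"
  have r1: "0 < r1" "r1 < 1" using rt0 by (auto simp: r1_def)
  have rad: "(G i (r *\<^sub>R \<sigma>) - G (\<not> i) (r *\<^sub>R \<sigma>)) \<bullet> \<sigma> \<le> B" if r: "r1 \<le> r" "r < 1" and \<sigma>: "norm \<sigma> = 1" for i r \<sigma>
  proof -
    have r0: "0 < r" using r r1 by linarith
    have "ln r1 \<le> ln r" using r(1) r1 by (intro ln_mono) auto
    then have "max (- 1/2) (2/3 * ln (\<rho> \<tau>0)) \<le> ln r" by (simp only: r1_def ln_exp)
    then have l: "- 1/2 \<le> ln r" "ln (\<rho> \<tau>0) \<le> 3/2 * ln r" "ln r < 0" using r r0 by auto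
    have "\<rho> \<tau>0 \<le> exp (3/2 * ln r)" using l(2) rt0 by (metis exp_le_cancel_iff exp_ln)
    \<comment> \<open>The reindexing by \<open>j = i\<close> gives solution \<open>i\<close> the
      role of \<open>True\<close>, so the two values of \<open>i\<close> yield the upper and the
      lower bound.\<close>
    then interpret reflection f K C "ln r" "\<lambda>j. u (j = i)" "\<lambda>j. G (j = i)" "\<lambda>j. H (j = i)"
      using K one_sided_lipschitz sol C0 l diff by unfold_locales auto
    show ?thesis
      using radial_derivative_diff_le_explicit[OF \<sigma> k_def w_def] r0 by (simp add: B_def)
  qed
  obtain B1 where B1: "0 \<le> B1" "\<And>\<tau> \<sigma> \<omega>. T \<le> \<tau> \<Longrightarrow> \<tau> < 0 \<Longrightarrow> norm \<sigma> = 1 \<Longrightarrow> norm \<omega> = 1 \<Longrightarrow> \<sigma> \<bullet> \<omega> = 0 \<Longrightarrow>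
      G True (\<rho> \<tau> *\<^sub>R \<sigma>) \<bullet> \<omega> \<le> B1"
    using tangential_gradient_bound[OF sol[of True] refl] by blast
  obtain B2 where B2: "0 \<le> B2" "\<And>\<tau> \<sigma> \<omega>. T \<le> \<tau> \<Longrightarrow> \<tau> < 0 \<Longrightarrow> norm \<sigma> = 1 \<Longrightarrow> norm \<omega> = 1 \<Longrightarrow> \<sigma> \<bullet> \<omega> = 0 \<Longrightarrow>
      G False (\<rho> \<tau> *\<^sub>R \<sigma>) \<bullet> \<omega> \<le> B2"
    using tangential_gradient_bound[OF sol[of False] refl] by blast
  define R where "R = max r1 (\<rho> T)"
  have "\<rho> T < 1" using rho_less_1[of T] T4 by simp
  then have R1: "0 < R" "R < 1" using r1 by (auto simp: R_def)
  have "compact ((\<lambda>x. G True x - G False x) ` cball 0 R)"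
    using R1 by (intro compact_continuous_image continuous_intros
        continuous_on_subset[OF sol_continuous(2)[OF sol[of True]]]
        continuous_on_subset[OF sol_continuous(2)[OF sol[of False]]]) auto
  then have "bounded ((\<lambda>x. G True x - G False x) ` cball 0 R)" by (rule compact_imp_bounded)
  then obtain M where "\<forall>y\<in>(\<lambda>x. G True x - G False x) ` cball 0 R. norm y \<le> M"
    unfolding bounded_iff by blast
  then have M: "norm (G True x - G False x) \<le> M" if "norm x \<le> R" for x using that by simp
  show thesis
  proof (rule that[of "max M (B + (B1 + B2))"])
    fix x :: 'a assume x: "norm x < 1"
    show "norm (G True x - G False x) \<le> max M (B + (B1 + B2))"
    proof (cases "norm x \<le> R")
      case False
      define r \<sigma> where "r = norm x" and "\<sigma> = x /\<^sub>R norm x"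
      have "x \<noteq> 0" using False R1 by auto
      then have \<sigma>: "norm \<sigma> = 1" and x_eq: "x = r *\<^sub>R \<sigma>" by (auto simp: \<sigma>_def r_def)
      have r: "r1 \<le> r" "\<rho> T \<le> r" "r < 1" using False x by (auto simp: R_def r_def)
      obtain \<tau> where \<tau>: "T \<le> \<tau>" "\<tau> < 0" "\<rho> \<tau> = r"
        by (rule rho_surj[of T r]) (use T4 r in auto)
      have "norm (G True x - G False x) \<le> B + (B1 + B2)"
      proof (rule norm_le_radial_tangential[OF \<sigma>])
        show "\<bar>(G True x - G False x) \<bullet> \<sigma>\<bar> \<le> B"
          using rad[OF r(1,3) \<sigma>, of True] rad[OF r(1,3) \<sigma>, of False]
          by (simp add: x_eq abs_le_iff inner_diff_left)
        fix \<omega> :: 'a assume "norm \<omega> = 1" "\<sigma> \<bullet> \<omega> = 0"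
        then show "(G True x - G False x) \<bullet> \<omega> \<le> B1 + B2"
          using B1(2)[OF \<tau>(1,2) \<sigma>, of \<omega>] B2(2)[OF \<tau>(1,2) \<sigma>, of "- \<omega>"]
          by (simp add: x_eq \<tau>(3) inner_diff_left)
      qed (use B1 B2 in simp)
      then show ?thesis by simp
    qed (use M in \<open>simp add: le_max_iff_disj\<close>)
  qed
qed

lemma gradient_diff:
  assumes "u differentiable (at x)" "v differentiable (at x)"
  shows "gradient (\<lambda>y. u y - v y) x = gradient u x - gradient v x"
proof -
  have "frechet_derivative (\<lambda>y. u y - v y) (at x) = (\<lambda>h. frechet_derivative u (at x) h - frechet_derivative v (at x) h)"
    using assms by (intro frechet_derivative_at[symmetric] has_derivative_diff)
      (simp_all add: frechet_derivative_works[symmetric])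
  then show ?thesis
    by (simp add: gradient_def partial_deriv_def scaleR_diff_left sum_subtractf)
qed

theorem theorem1p2:
  fixes f ftilde :: "real \<Rightarrow> real" and a K :: real
    and u1 u2 :: "real ^ 'n \<Rightarrow> real"
  assumes "f C1_differentiable_on UNIV"
    and "f a > 0"
    and "\<And>t. t > a \<Longrightarrow> f t \<ge> 0"
    and "\<exists>b>a. set_integrable lborel {b..} (\<lambda>t. 1 / sqrt (integral {a..t} f))"
    and "mono ftilde"
    and "\<And>t. f t = ftilde t - K * t"
    and "large_solution f (ball 0 1) u1"
    and "large_solution f (ball 0 1) u2"
  shows "in_Linfty (ball 0 1) (\<lambda>x. norm (gradient (\<lambda>y. u1 y - u2 y) x))"
proof -
  define u where "u = (\<lambda>i. if i then u1 else u2)"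
  \<comment> \<open>The given K may be negative, while the comparison works with a nonnegative
    constant; enlarging it only weakens the lower bound for ordered arguments.\<close>
  define K' where "K' = max K 0"
  have sol: "blowup_solution f (u i) (gradient (u i)) (\<lambda>x. frechet_derivative (gradient (u i)) (at x))" for i
    using assms(7,8) by (auto simp: u_def intro: large_solution_sol)
  have one_sided_lipschitz: "- K' * (s - t) \<le> f s - f t" if "t \<le> s" for s t
  proof -
    have "K * (s - t) \<le> K' * (s - t)" using that by (intro mult_right_mono) (auto simp: K'_def)
    moreover have "ftilde t \<le> ftilde s" using assms(5) that by (rule monoD)
    ultimately show ?thesis by (simp add: assms(6) algebra_simps)
  qed
  obtain M where M: "\<And>x. norm x < 1 \<Longrightarrow> norm (gradient (u True) x - gradient (u False) x) \<le> M"
    by (rule gradient_difference_bounded[where u = u and G = "\<lambda>i. gradient (u i)", OF sol _ one_sided_lipschitz assms(3)]) (auto simp: K'_def)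
  have eq: "gradient (\<lambda>y. u1 y - u2 y) x = gradient u1 x - gradient u2 x" if "x \<in> ball 0 1" for x
    using assms(7,8) that
    by (intro gradient_diff) (auto simp: large_solution_def classical_solution_def C2_on_def C1_on_def)
  have "continuous_on (ball 0 1) (\<lambda>x. norm (gradient u1 x - gradient u2 x))"
    using sol_continuous(2)[OF sol[of True]] sol_continuous(2)[OF sol[of False]]
    by (auto simp: u_def intro: continuous_intros)
  then have "continuous_on (ball 0 1) (\<lambda>x. norm (gradient (\<lambda>y. u1 y - u2 y) x))"
    by (rule continuous_on_eq) (simp add: eq)
  then have "(\<lambda>x. norm (gradient (\<lambda>y. u1 y - u2 y) x)) \<in> borel_measurable (lebesgue_on (ball 0 1))"
    by (rule continuous_imp_measurable_on_sets_lebesgue) simp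
  moreover have "AE x in lebesgue_on (ball 0 1). \<bar>norm (gradient (\<lambda>y. u1 y - u2 y) x)\<bar> \<le> M"
    using M by (intro AE_I2) (simp add: eq u_def)
  ultimately show ?thesis unfolding in_Linfty_def by blast
qed

end
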